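(* Let $(\xi_n)_{n\in\mathbb N}$ be a sequence of standardized normal random vectors in $\mathbb R^{\Omega_n}$ having covariance matrices $\kappa_n\in\mathbb R^{\Omega_n\times\Omega_n}$ satisfying $$\lim_{n\to\infty}\sum_{\omega\ne\omega'}|\kappa_n(\omega,\omega')|\left(\frac{\log|\Omega_n|}{|\Omega_n|^2}\right)^{1/(1+|\kappa_n(\omega,\omega')|)}=0.$$ Then $\|\xi_n\|_\infty=\max_{\omega\in\Omega_n}|\xi_n(\omega)|$ is of Gumbel type with normalization constants $$a(\chi,|\Omega_n|)=\frac1{\sqrt{2\log|\Omega_n|}},\qquad b(\chi,|\Omega_n|)=\sqrt{2\log|\Omega_n|}-\frac{\log\log|\Omega_n|+\log\pi}{2\sqrt{2\log|\Omega_n|}},$$ that is, $\mathbf P\{\|\xi_n\|_\infty\le a(\chi,|\Omega_n|)z+b(\chi,|\Omega_n|)\}\to\exp(-e^{-z})$ as $n\to\infty$ for every $z\in\mathbb R$.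
   Context: $(\Omega_n)_{n\in\mathbb N}$ is a sequence of finite index sets with monotonically increasing cardinalities and $|\Omega_n|\to\infty$. A standardized normal random vector is a (jointly) normal vector with $\xi_n(\omega)\sim N(0,1)$ for every $\omega\in\Omega_n$. The sum runs over all $(\omega,\omega')\in\Omega_n^2$ with $\omega\ne\omega'$. *)

theory Defs
  imports "HOL-Probability.Probability"
begin

text \<open>Univariate normal law; \<open>\<sigma> = 0\<close> is the degenerate law concentrated at \<open>\<mu>\<close>.\<close>

definition normal_rv :: "'a measure \<Rightarrow> ('a \<Rightarrow> real) \<Rightarrow> real \<Rightarrow> real \<Rightarrow> bool" where
  "normal_rv M X \<mu> \<sigma> \<longleftrightarrow>
     (\<sigma> > 0 \<and> distributed M lborel X (normal_density \<mu> \<sigma>)) \<or>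
     (\<sigma> = 0 \<and> X \<in> borel_measurable M \<and> (AE x in M. X x = \<mu>))"

text \<open>Joint normality: every linear combination of the coordinates is normal. Degenerate laws
  have to be admitted here, because covariance matrices may be singular.\<close>

definition normal_vector :: "'a measure \<Rightarrow> 'i set \<Rightarrow> ('i \<Rightarrow> 'a \<Rightarrow> real) \<Rightarrow> bool" where
  "normal_vector M I X \<longleftrightarrow>
     (\<forall>i\<in>I. X i \<in> borel_measurable M) \<and>
     (\<forall>c :: 'i \<Rightarrow> real. \<exists>\<mu> \<sigma>. normal_rv M (\<lambda>x. \<Sum>i\<in>I. c i * X i x) \<mu> \<sigma>)"

definition standardized_normal_vector :: "'a measure \<Rightarrow> 'i set \<Rightarrow> ('i \<Rightarrow> 'a \<Rightarrow> real) \<Rightarrow> bool" where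
  "standardized_normal_vector M I X \<longleftrightarrow>
     normal_vector M I X \<and> (\<forall>i\<in>I. normal_rv M (X i) 0 1)"

definition covariance :: "'a measure \<Rightarrow> ('a \<Rightarrow> real) \<Rightarrow> ('a \<Rightarrow> real) \<Rightarrow> real" where
  "covariance M X Y =
     (\<integral>x. (X x - (\<integral>y. X y \<partial>M)) * (Y x - (\<integral>y. Y y \<partial>M)) \<partial>M)"

definition has_covariance_matrix ::
    "'a measure \<Rightarrow> 'i set \<Rightarrow> ('i \<Rightarrow> 'a \<Rightarrow> real) \<Rightarrow> ('i \<Rightarrow> 'i \<Rightarrow> real) \<Rightarrow> bool" where
  "has_covariance_matrix M I X K \<longleftrightarrow> (\<forall>i\<in>I. \<forall>j\<in>I. K i j = covariance M (X i) (X j))"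

text \<open>Meaningful for finite nonempty \<open>I\<close> only; \<open>Max {}\<close> is an unspecified real number.\<close>

definition max_norm :: "'i set \<Rightarrow> ('i \<Rightarrow> real) \<Rightarrow> real" where
  "max_norm I v = Max ((\<lambda>i. \<bar>v i\<bar>) ` I)"

text \<open>The variables \<open>Y n\<close> may live on different probability spaces \<open>M n\<close>.\<close>

definition gumbel_type ::
    "(nat \<Rightarrow> 'a measure) \<Rightarrow> (nat \<Rightarrow> 'a \<Rightarrow> real) \<Rightarrow> (nat \<Rightarrow> real) \<Rightarrow> (nat \<Rightarrow> real) \<Rightarrow> bool" where
  "gumbel_type M Y a b \<longleftrightarrow>
     (\<forall>z. (\<lambda>n. \<P>(x in M n. Y n x \<le> a n * z + b n)) \<longlonglongrightarrow> exp (- exp (- z)))"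

text \<open>Normalization constants for the maximum of \<open>N\<close> absolute values of standard normals. They are
  junk for \<open>N \<le> 1\<close>, where \<open>ln N = 0\<close> and hence division by zero and \<open>ln 0\<close> occur.\<close>

definition a_chi :: "nat \<Rightarrow> real" where
  "a_chi N = 1 / sqrt (2 * ln (real N))"

definition b_chi :: "nat \<Rightarrow> real" where
  "b_chi N = sqrt (2 * ln (real N)) -
     (ln (ln (real N)) + ln pi) / (2 * sqrt (2 * ln (real N)))"

end

(* The theorem follows from a comparison inequality of Berman type: for u > 0, the probability that
   |X i| <= u for all i differs from its value for independent standard normals by at most
   1/2 * sum over i ~= j of |K i j| * exp (- u^2 / (1 + |K i j|)).  At the Gumbel threshold the
   exponential is at most a constant times the powr term of the hypothesis.

   To compare, interpolate the covariance linearly from the identity to K, realised by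
   sqrt t * X + sqrt (1 - t) * Z with Z independent of X.  For a product of even trigonometric
   polynomials p in the coordinates, expectations are finite sums of values of the characteristic
   function, so covariances may be singular and no joint density is needed.  The derivative in t
   is half the sum of K i j times expectations with p' in the i-th and j-th factor.  These are
   bounded using only the bivariate density, which is dominated by a product of one-dimensional
   Gaussian weights.  Finally p tends to a C^1 function equal to 1 on {-u..u} and then to the
   indicator of {-u..u}; |p'| concentrates just outside {-u..u}, where the weights are at most
   exp (- u^2 / (2 * (1 + |K i j|))). *)

theory Submission
  imports Defs "HOL-Real_Asymp.Real_Asymp"
begin

text \<open>The constant 1/2 in the comparison inequality is the product of 1/2 from the derivative
  in t, 1/(2 pi) from the bivariate density, pi/2 from integrating 1/sqrt(1 - t^2) over [0, 1], and
  4 = 2^2, because |p'| has limiting mass one on each side of the origin and occurs twice. Perfect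
  correlation is no obstacle: at time t the correlation is t K i j, so the density has normalising
  factor at most 1/sqrt(1 - t^2), integrable up to t = 1; and |t K i j| <= |K i j| lets one Gaussian
  weight serve for all t. The bound involves p only through sup |p| and weighted integrals of |p'|;
  for the limiting C^1 function it is free of the width of the descent, so the passage to the
  indicator costs nothing. Periodic functions cannot approximate a compactly supported one uniformly
  on the line; the period therefore grows, convergence is pointwise, and domination comes from the
  Gaussian weights. At the threshold u^2 = 2 ln N - ln ln N + 2 z - ln pi + o(1), so exp(-u^2) is of
  order ln N / N^2; this explains both the base and the exponent in the hypothesis.\<close>

subsection \<open>Gaussian families\<close>

text \<open>The law is prescribed through its characteristic function, that of a centred Gaussian
  vector with covariance \<open>K\<close>. This form admits singular \<open>K\<close> and is exactly
  what expectations of exponential sums require.\<close>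

definition gaussian_family ::
    "'a measure \<Rightarrow> 'i set \<Rightarrow> ('i \<Rightarrow> 'a \<Rightarrow> real) \<Rightarrow> ('i \<Rightarrow> 'i \<Rightarrow> real) \<Rightarrow> bool" where
  "gaussian_family M I X K \<longleftrightarrow> prob_space M \<and> (\<forall>i\<in>I. X i \<in> borel_measurable M) \<and>
     (\<forall>c. (\<integral>x. cis (\<Sum>i\<in>I. c i * X i x) \<partial>M)
        = of_real (exp (- (\<Sum>i\<in>I. \<Sum>j\<in>I. c i * c j * K i j) / 2)))"

lemma gaussian_family_cis:
  assumes "gaussian_family M I X K"
  shows "(\<integral>x. cis (\<Sum>i\<in>I. c i * X i x) \<partial>M)
        = of_real (exp (- (\<Sum>i\<in>I. \<Sum>j\<in>I. c i * c j * K i j) / 2))"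
  using assms by (simp add: gaussian_family_def)

lemma borel_measurable_cis [measurable (raw)]:
  assumes "f \<in> borel_measurable M"
  shows "(\<lambda>x. cis (f x)) \<in> borel_measurable M"
  using assms borel_measurable_continuous_onI[of cis] continuous_on_cis[of UNIV "\<lambda>x. x"]
  by (auto intro: measurable_compose)

lemma (in finite_measure) integrable_cis:
  assumes "f \<in> borel_measurable M"
  shows "integrable M (\<lambda>x. cis (f x))"
  by (rule integrable_const_bound[where B = 1]) (use assms in auto)

lemma integral_cis_std_normal:
  "(\<integral>x. cis (t * x) \<partial>std_normal_distribution) = of_real (exp (- t\<^sup>2 / 2))"
  using fun_cong[OF char_std_normal_distribution, of t] by (simp add: char_def cis_conv_exp)

section \<open>From standardized normal vectors to Gaussian families\<close>

context prob_space
begin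

text \<open>Degenerate and nondegenerate laws obey the same moment and characteristic function
  formulas, so linear combinations later need no case distinction on \<open>\<sigma>\<close>. The
  nondegenerate case reduces to the standard normal law by standardization.\<close>

lemma
  assumes "normal_rv M X \<mu> \<sigma>"
  shows normal_rv_measurable: "X \<in> borel_measurable M"
    and normal_rv_integrable: "integrable M X"
    and normal_rv_integrable_square: "integrable M (\<lambda>x. (X x)\<^sup>2)"
    and normal_rv_expectation: "expectation X = \<mu>"
    and normal_rv_variance: "variance X = \<sigma>\<^sup>2"
    and normal_rv_cis: "(\<integral>x. cis (X x) \<partial>M) = cis \<mu> * of_real (exp (- \<sigma>\<^sup>2 / 2))"
proof -
  have "X \<in> borel_measurable M \<and> integrable M X \<and> integrable M (\<lambda>x. (X x)\<^sup>2) \<and> expectation X = \<mu> \<and>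
      variance X = \<sigma>\<^sup>2 \<and> (\<integral>x. cis (X x) \<partial>M) = cis \<mu> * of_real (exp (- \<sigma>\<^sup>2 / 2))"
  proof (cases "\<sigma> = 0")
    case True
    then have [measurable]: "X \<in> borel_measurable M" and ae: "AE x in M. X x = \<mu>"
      using assms by (auto simp: normal_rv_def)
    have "integrable M X" 
      by (subst integrable_cong_AE[where g = "\<lambda>_. \<mu>"]) (use ae in auto)
    moreover have "integrable M (\<lambda>x. (X x)\<^sup>2)" 
      by (subst integrable_cong_AE[where g = "\<lambda>_. \<mu>\<^sup>2"]) (use ae in auto)
    moreover have e: "expectation X = \<mu>"
      by (subst integral_cong_AE[where g = "\<lambda>_. \<mu>"]) (use ae in \<open>auto simp: prob_space\<close>)
    moreover have "variance X = 0" unfolding e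
      by (subst integral_cong_AE[where g = "\<lambda>_. 0"]) (use ae in auto)
    moreover have "(\<integral>x. cis (X x) \<partial>M) = cis \<mu>"
      by (subst integral_cong_AE[where g = "\<lambda>_. cis \<mu>"]) (use ae in \<open>auto simp: prob_space\<close>)
    ultimately show ?thesis using True by simp
  next
    case False
    then have pos: "0 < \<sigma>" and D: "distributed M lborel X (normal_density \<mu> \<sigma>)"
      using assms by (auto simp: normal_rv_def)
    have [measurable]: "X \<in> borel_measurable M" using D by (simp add: distributed_def)
    have D': "distributed M lborel (\<lambda>x. (X x - \<mu>) / \<sigma>) std_normal_density"
      using D normal_standard_normal_convert[OF pos] by simp
    have 1: "integrable M X"
      using distributed_integrable[OF D, of "\<lambda>x. x"] integrable_normal_moment_nz_1[OF pos] by simp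
    have "integrable M (\<lambda>x. (X x - \<mu>)\<^sup>2)"
      using distributed_integrable[OF D, of "\<lambda>x. (x - \<mu>)\<^sup>2"] integrable_normal_moment[OF pos] by simp
    then have "integrable M (\<lambda>x. (X x - \<mu>)\<^sup>2 + 2 * \<mu> * X x - \<mu>\<^sup>2)"
      using 1 by (intro Bochner_Integration.integrable_diff Bochner_Integration.integrable_add) auto
    then have 2: "integrable M (\<lambda>x. (X x)\<^sup>2)"
      by (rule Bochner_Integration.integrable_cong[THEN iffD1, rotated -1])
        (auto simp: power2_eq_square algebra_simps)
    have "(\<integral>x. cis (X x) \<partial>M) = (\<integral>x. cis \<mu> * cis (\<sigma> * ((X x - \<mu>) / \<sigma>)) \<partial>M)"
      using pos by (simp add: cis_mult)
    also have "\<dots> = cis \<mu> * (\<integral>x. cis (\<sigma> * ((X x - \<mu>) / \<sigma>)) \<partial>M)"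
      by simp
    also have "(\<integral>x. cis (\<sigma> * ((X x - \<mu>) / \<sigma>)) \<partial>M) =
       (\<integral>y. cis (\<sigma> * y) \<partial>distr M lborel (\<lambda>x. (X x - \<mu>) / \<sigma>))"
      by (subst integral_distr) auto
    also have "distr M lborel (\<lambda>x. (X x - \<mu>) / \<sigma>) = std_normal_distribution"
      using D' by (simp add: distributed_def)
    finally have 3: "(\<integral>x. cis (X x) \<partial>M) = cis \<mu> * of_real (exp (- \<sigma>\<^sup>2 / 2))"
      by (simp add: integral_cis_std_normal)
    show ?thesis
      using 1 2 3 normal_distributed_expectation[OF pos D] normal_distributed_variance[OF pos D] by simp
  qed
  then show "X \<in> borel_measurable M" "integrable M X" "integrable M (\<lambda>x. (X x)\<^sup>2)" "expectation X = \<mu>"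
      "variance X = \<sigma>\<^sup>2" "(\<integral>x. cis (X x) \<partial>M) = cis \<mu> * of_real (exp (- \<sigma>\<^sup>2 / 2))"
    by auto
qed

lemma integrable_mult_square:
  fixes X Y :: "'a \<Rightarrow> real"
  assumes [measurable]: "X \<in> borel_measurable M" "Y \<in> borel_measurable M"
    and "integrable M (\<lambda>x. (X x)\<^sup>2)" "integrable M (\<lambda>x. (Y x)\<^sup>2)"
  shows "integrable M (\<lambda>x. X x * Y x)"
proof (rule Bochner_Integration.integrable_bound)
  show "integrable M (\<lambda>x. (X x)\<^sup>2 + (Y x)\<^sup>2)" using assms by auto
  have "\<bar>x * y\<bar> \<le> x\<^sup>2 + y\<^sup>2" for x y :: real
    using sum_squares_bound[of "\<bar>x\<bar>" "\<bar>y\<bar>"] mult_nonneg_nonneg[of "\<bar>x\<bar>" "\<bar>y\<bar>"]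
    unfolding power2_abs abs_mult mult.assoc by linarith
  then show "AE x in M. norm (X x * Y x) \<le> norm ((X x)\<^sup>2 + (Y x)\<^sup>2)" by auto
qed measurable

text \<open>Joint normality leaves only mean and variance of each linear combination open. Both
  follow from moments: the mean is 0 and the variance is the quadratic form of
  \<open>K\<close>.\<close>

lemma standardized_normal_vector_gaussian_family:
  assumes fin: "finite I" and std: "standardized_normal_vector M I X"
    and cov: "has_covariance_matrix M I X K"
  shows "gaussian_family M I X K"
    and "\<And>i. i \<in> I \<Longrightarrow> K i i = 1"
    and "\<And>i j. i \<in> I \<Longrightarrow> j \<in> I \<Longrightarrow> \<bar>K i j\<bar> \<le> 1"
    and "\<And>i j. i \<in> I \<Longrightarrow> j \<in> I \<Longrightarrow> K i j = K j i"
proof -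
  have n: "normal_rv M (X i) 0 1" if "i \<in> I" for i
    using std that by (auto simp: standardized_normal_vector_def)
  have [measurable]: "X i \<in> borel_measurable M" if "i \<in> I" for i
    using normal_rv_measurable[OF n[OF that]] .
  have int: "integrable M (X i)" "expectation (X i) = 0" if "i \<in> I" for i
    using normal_rv_integrable[OF n[OF that]] normal_rv_expectation[OF n[OF that]] by auto
  have int2: "integrable M (\<lambda>x. X i x * X j x)" if "i \<in> I" "j \<in> I" for i j
    using that normal_rv_integrable_square[OF n] by (intro integrable_mult_square) auto
  have K: "K i j = expectation (\<lambda>x. X i x * X j x)" if "i \<in> I" "j \<in> I" for i j
    using cov that int by (simp add: has_covariance_matrix_def covariance_def)
  have var: "(\<integral>x. (\<Sum>i\<in>I. c i * X i x)\<^sup>2 \<partial>M) = (\<Sum>i\<in>I. \<Sum>j\<in>I. c i * c j * K i j)" for c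
  proof -
    have "(\<Sum>i\<in>I. c i * X i x)\<^sup>2 = (\<Sum>i\<in>I. \<Sum>j\<in>I. c i * c j * (X i x * X j x))" for x
      by (simp add: power2_eq_square sum_product algebra_simps)
    then have "(\<integral>x. (\<Sum>i\<in>I. c i * X i x)\<^sup>2 \<partial>M) = (\<integral>x. (\<Sum>i\<in>I. \<Sum>j\<in>I. c i * c j * (X i x * X j x)) \<partial>M)"
      by simp
    also have "\<dots> = (\<Sum>i\<in>I. \<integral>x. (\<Sum>j\<in>I. c i * c j * (X i x * X j x)) \<partial>M)"
      using int2 by (intro Bochner_Integration.integral_sum Bochner_Integration.integrable_sum integrable_mult_right) auto
    also have "\<dots> = (\<Sum>i\<in>I. \<Sum>j\<in>I. \<integral>x. c i * c j * (X i x * X j x) \<partial>M)"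
      using int2 by (intro sum.cong refl Bochner_Integration.integral_sum integrable_mult_right) auto
    also have "\<dots> = (\<Sum>i\<in>I. \<Sum>j\<in>I. c i * c j * K i j)"
      by (intro sum.cong refl) (simp only: K Bochner_Integration.integral_mult_right_zero)
    finally show ?thesis .
  qed
  have e: "expectation (\<lambda>x. \<Sum>i\<in>I. c i * X i x) = 0" for c
    using int by simp
  have "(\<integral>x. cis (\<Sum>i\<in>I. c i * X i x) \<partial>M) = of_real (exp (- (\<Sum>i\<in>I. \<Sum>j\<in>I. c i * c j * K i j) / 2))" for c
  proof -
    obtain \<mu> \<sigma> where N: "normal_rv M (\<lambda>x. \<Sum>i\<in>I. c i * X i x) \<mu> \<sigma>"
      using std unfolding standardized_normal_vector_def normal_vector_def by blast
    have "\<mu> = 0" using normal_rv_expectation[OF N] e by simp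
    moreover have "\<sigma>\<^sup>2 = (\<Sum>i\<in>I. \<Sum>j\<in>I. c i * c j * K i j)"
      using normal_rv_variance[OF N] by (simp only: e var diff_zero)
    ultimately show ?thesis using normal_rv_cis[OF N] by simp
  qed
  then show "gaussian_family M I X K"
    by (auto simp: gaussian_family_def prob_space_axioms)
  show d: "K i i = 1" if "i \<in> I" for i
    using normal_rv_variance[OF n[OF that]] K[of i i] int that by (simp add: power2_eq_square)
  show "K i j = K j i" if "i \<in> I" "j \<in> I" for i j
    using K that by (simp add: mult.commute)
  show "\<bar>K i j\<bar> \<le> 1" if ij: "i \<in> I" "j \<in> I" for i j
  proof -
    \<comment> \<open>These second moments equal 2 + 2 \<open>K i j\<close> and 2 - 2
      \<open>K i j\<close>, which bounds the correlation from both sides.\<close>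
    have "0 \<le> expectation (\<lambda>x. (X i x + X j x)\<^sup>2)" "0 \<le> expectation (\<lambda>x. (X i x - X j x)\<^sup>2)"
      by auto
    moreover have "expectation (\<lambda>x. (X i x + X j x)\<^sup>2) = K i i + K j j + 2 * K i j"
      using ij int2 by (simp add: K power2_eq_square algebra_simps)
    moreover have "expectation (\<lambda>x. (X i x - X j x)\<^sup>2) = K i i + K j j - 2 * K i j"
      using ij int2 by (simp add: K power2_eq_square algebra_simps)
    ultimately show ?thesis using d ij by simp
  qed
qed

end

section \<open>Restriction, independent families and interpolation\<close>

lemma gaussian_family_mono:
  assumes G: "gaussian_family M I X K" and "J \<subseteq> I" "finite I"
  shows "gaussian_family M J X K"
proof -
  have "(\<integral>x. cis (\<Sum>i\<in>J. c i * X i x) \<partial>M) = of_real (exp (- (\<Sum>i\<in>J. \<Sum>j\<in>J. c i * c j * K i j) / 2))" for c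
  proof -
    define d where "d i = (if i \<in> J then c i else 0)" for i
    have "(\<Sum>i\<in>J. c i * X i x) = (\<Sum>i\<in>I. d i * X i x)" for x
      using assms by (intro sum.mono_neutral_cong_left) (auto simp: d_def)
    moreover have "(\<Sum>i\<in>J. \<Sum>j\<in>J. c i * c j * K i j) = (\<Sum>i\<in>I. \<Sum>j\<in>I. d i * d j * K i j)"
      using assms by (intro sum.mono_neutral_cong_left) (auto simp: d_def intro!: sum.neutral sum.mono_neutral_cong_left)
    ultimately show ?thesis using gaussian_family_cis[OF G, of d] by simp
  qed
  then show ?thesis using assms by (auto simp: gaussian_family_def)
qed

lemma prob_space_std_normal: "prob_space std_normal_distribution"
  by (rule prob_space_normal_density) simp

interpretation std_normal: prob_space std_normal_distribution
  by (rule prob_space_std_normal)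

lemma gaussian_family_iid:
  assumes "finite I"
  shows "gaussian_family (Pi\<^sub>M I (\<lambda>_. std_normal_distribution)) I (\<lambda>i y. y i) (\<lambda>i j. if i = j then 1 else 0)"
proof -
  interpret P: product_prob_space "\<lambda>_. std_normal_distribution" I
    by unfold_locales
  have "(\<integral>y. cis (\<Sum>i\<in>I. c i * y i) \<partial>Pi\<^sub>M I (\<lambda>_. std_normal_distribution))
     = of_real (exp (- (\<Sum>i\<in>I. \<Sum>j\<in>I. c i * c j * (if i = j then 1 else 0)) / 2))" for c
  proof -
    have "(\<integral>y. cis (\<Sum>i\<in>I. c i * y i) \<partial>Pi\<^sub>M I (\<lambda>_. std_normal_distribution))
       = (\<integral>y. (\<Prod>i\<in>I. cis (c i * y i)) \<partial>Pi\<^sub>M I (\<lambda>_. std_normal_distribution))"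
      using assms by (simp add: cis_conv_exp exp_sum sum_distrib_left)
    also have "\<dots> = (\<Prod>i\<in>I. \<integral>y. cis (c i * y) \<partial>std_normal_distribution)"
      using assms by (subst P.product_integral_prod) (auto intro: std_normal.integrable_cis)
    also have "\<dots> = of_real (exp (\<Sum>i\<in>I. - (c i)\<^sup>2 / 2))"
      using assms by (simp add: integral_cis_std_normal exp_sum)
    also have "(\<Sum>i\<in>I. - (c i)\<^sup>2 / 2) = - (\<Sum>i\<in>I. \<Sum>j\<in>I. c i * c j * (if i = j then 1 else 0)) / 2"
      using assms by (simp add: power2_eq_square sum_negf sum_divide_distrib if_distrib cong: if_cong)
    finally show ?thesis .
  qed
  moreover have "prob_space (Pi\<^sub>M I (\<lambda>_. std_normal_distribution))"
    by (rule P.prob_space_axioms)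
  ultimately show ?thesis by (auto simp: gaussian_family_def)
qed

lemma gaussian_family_interpolate:
  assumes G: "gaussian_family M I X K" and H: "gaussian_family N I Y L" and t: "0 \<le> t" "t \<le> 1"
  shows "gaussian_family (M \<Otimes>\<^sub>M N) I (\<lambda>i (x, y). sqrt t * X i x + sqrt (1 - t) * Y i y)
    (\<lambda>i j. t * K i j + (1 - t) * L i j)"
proof -
  interpret M: prob_space M using G by (simp add: gaussian_family_def)
  interpret N: prob_space N using H by (simp add: gaussian_family_def)
  interpret MN: pair_prob_space M N ..
  have [measurable]: "X i \<in> borel_measurable M" "Y i \<in> borel_measurable N" if "i \<in> I" for i
    using G H that by (auto simp: gaussian_family_def)
  have "(\<integral>z. cis (\<Sum>i\<in>I. c i * (case z of (x, y) \<Rightarrow> sqrt t * X i x + sqrt (1 - t) * Y i y)) \<partial>(M \<Otimes>\<^sub>M N))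
      = of_real (exp (- (\<Sum>i\<in>I. \<Sum>j\<in>I. c i * c j * (t * K i j + (1 - t) * L i j)) / 2))" for c
  proof -
    have "(\<integral>z. cis (\<Sum>i\<in>I. c i * (case z of (x, y) \<Rightarrow> sqrt t * X i x + sqrt (1 - t) * Y i y)) \<partial>(M \<Otimes>\<^sub>M N))
      = (\<integral>x. (\<integral>y. cis (\<Sum>i\<in>I. c i * (sqrt t * X i x + sqrt (1 - t) * Y i y)) \<partial>N) \<partial>M)"
      by (subst MN.integral_fst'[symmetric]) (auto intro!: MN.P.integrable_cis)
    also have "\<dots> = (\<integral>x. (\<integral>y. cis (\<Sum>i\<in>I. (c i * sqrt t) * X i x) * cis (\<Sum>i\<in>I. (c i * sqrt (1 - t)) * Y i y) \<partial>N) \<partial>M)"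
      by (simp add: cis_mult sum.distrib algebra_simps)
    also have "\<dots> = of_real (exp (- (\<Sum>i\<in>I. \<Sum>j\<in>I. (c i * sqrt t) * (c j * sqrt t) * K i j) / 2)) *
        of_real (exp (- (\<Sum>i\<in>I. \<Sum>j\<in>I. (c i * sqrt (1 - t)) * (c j * sqrt (1 - t)) * L i j) / 2))"
      by (simp only: gaussian_family_cis[OF G] gaussian_family_cis[OF H] Bochner_Integration.integral_mult_right_zero integral_mult_left_zero)
    also have "\<dots> = of_real (exp (- (\<Sum>i\<in>I. \<Sum>j\<in>I. (c i * sqrt t) * (c j * sqrt t) * K i j) / 2
         + - (\<Sum>i\<in>I. \<Sum>j\<in>I. (c i * sqrt (1 - t)) * (c j * sqrt (1 - t)) * L i j) / 2))"
      by (simp only: exp_add of_real_mult)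
    also have "- (\<Sum>i\<in>I. \<Sum>j\<in>I. (c i * sqrt t) * (c j * sqrt t) * K i j) / 2
         + - (\<Sum>i\<in>I. \<Sum>j\<in>I. (c i * sqrt (1 - t)) * (c j * sqrt (1 - t)) * L i j) / 2
       = - ((\<Sum>i\<in>I. \<Sum>j\<in>I. (c i * sqrt t) * (c j * sqrt t) * K i j)
         + (\<Sum>i\<in>I. \<Sum>j\<in>I. (c i * sqrt (1 - t)) * (c j * sqrt (1 - t)) * L i j)) / 2"
      by (simp add: field_simps)
    also have "\<dots> = - (\<Sum>i\<in>I. \<Sum>j\<in>I. c i * c j * (sqrt t * sqrt t * K i j + sqrt (1 - t) * sqrt (1 - t) * L i j)) / 2"
      by (simp only: sum.distrib[symmetric]) (simp add: algebra_simps del: real_sqrt_mult_self)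
    finally show ?thesis using t by simp
  qed
  then show ?thesis by (auto simp: gaussian_family_def MN.P.prob_space_axioms)
qed

subsection \<open>Even trigonometric polynomials of Gaussian families\<close>

text \<open>An even trigonometric polynomial of period \<open>2 * pi / l\<close>, written as a
  polynomial in the cosine: Weierstrass approximation can then be carried out on
  \<open>{-1..1}\<close>.\<close>

definition cos_poly :: "real \<Rightarrow> real poly \<Rightarrow> real \<Rightarrow> real" where
  "cos_poly l P x = poly P (cos (l * x))"

definition cos_poly_deriv :: "real \<Rightarrow> real poly \<Rightarrow> real \<Rightarrow> real" where
  "cos_poly_deriv l P x = - (l * sin (l * x) * poly (pderiv P) (cos (l * x)))"

lemma cos_poly_measurable [measurable]: "cos_poly l P \<in> borel_measurable borel"
  unfolding cos_poly_def by (intro borel_measurable_continuous_onI continuous_intros)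

lemma cos_poly_deriv_measurable [measurable]: "cos_poly_deriv l P \<in> borel_measurable borel"
  unfolding cos_poly_deriv_def by (intro borel_measurable_continuous_onI continuous_intros)

lemma cos_poly_has_derivative: "(cos_poly l P has_real_derivative cos_poly_deriv l P x) (at x)"
  unfolding cos_poly_def[abs_def] cos_poly_deriv_def
  by (auto intro!: derivative_eq_intros poly_DERIV[THEN DERIV_chain2])

text \<open>Multiplication by cos x halves each coefficient and moves its frequency by +1 and by -1.
  A list of coefficient-frequency pairs tolerates the repeated frequencies this produces.\<close>

lemma poly_cos_eq_exp_sum_list:
  "\<exists>L :: (complex \<times> real) list. \<forall>x. of_real (poly P (cos x)) = (\<Sum>(c, s)\<leftarrow>L. c * cis (s * x))"
proof (induction P)
  case 0
  show ?case by (intro exI[of _ "[]"]) simp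
next
  case (pCons b P)
  then obtain L where L: "\<And>x. of_real (poly P (cos x)) = (\<Sum>(c, s)\<leftarrow>L. c * cis (s * x))" by blast
  let ?L = "(of_real b, 0) # map (\<lambda>(c, s). (c / 2, s + 1)) L @ map (\<lambda>(c, s). (c / 2, s - 1)) L"
  have shift: "of_real (cos x) * (\<Sum>(c, s)\<leftarrow>L. c * cis (s * x)) =
      (\<Sum>(c, s)\<leftarrow>map (\<lambda>(c, s). (c / 2, s + 1)) L @ map (\<lambda>(c, s). (c / 2, s - 1)) L. c * cis (s * x))"
    for x :: real and L :: "(complex \<times> real) list"
  proof (induction L)
    case (Cons p L)
    have "of_real (cos x) * (c * cis (s * x)) = c / 2 * cis ((s + 1) * x) + c / 2 * cis ((s - 1) * x)" for c s
      by (simp add: complex_eq_iff cos_add sin_add cos_diff sin_diff algebra_simps add_divide_distrib diff_divide_distrib)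
    then show ?case using Cons.IH by (cases p) (simp add: distrib_left)
  qed simp
  have "\<forall>x. of_real (poly (pCons b P) (cos x)) = (\<Sum>(c, s)\<leftarrow>?L. c * cis (s * x))"
    using shift[of _ L] by (simp add: L)
  then show ?case by blast
qed

text \<open>Both expansions share coefficients and frequencies, since the second is the termwise
  derivative of the first. Differentiating one factor of a product thus only inserts
  \<open>\<i> * a s\<close>.\<close>

lemma cos_poly_eq_exp_sum:
  obtains n :: nat and C :: "nat \<Rightarrow> complex" and a :: "nat \<Rightarrow> real" where
    "\<And>x. of_real (cos_poly l P x) = (\<Sum>s<n. C s * cis (a s * x))"
    "\<And>x. of_real (cos_poly_deriv l P x) = (\<Sum>s<n. C s * (\<i> * a s) * cis (a s * x))"
proof -
  obtain L :: "(complex \<times> real) list"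
    where L: "\<And>x. of_real (poly P (cos x)) = (\<Sum>(c, s)\<leftarrow>L. c * cis (s * x))"
    using poly_cos_eq_exp_sum_list[of P] by blast
  define C a where "C s = fst (L ! s)" and "a s = l * snd (L ! s)" for s
  have 1: "of_real (cos_poly l P x) = (\<Sum>s<length L. C s * cis (a s * x))" for x
    by (simp add: cos_poly_def L sum_list_sum_nth C_def a_def case_prod_unfold atLeast0LessThan ac_simps)
  have "((\<lambda>x. complex_of_real (cos_poly l P x)) has_vector_derivative of_real (cos_poly_deriv l P x)) (at x)" for x
    using cos_poly_has_derivative[of l P x]
    by (auto intro!: has_vector_derivative_of_real simp: has_real_derivative_iff_has_vector_derivative)
  moreover have "((\<lambda>x. complex_of_real (cos_poly l P x)) has_vector_derivative
       (\<Sum>s<length L. C s * (\<i> * a s) * cis (a s * x))) (at x)" for x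
  proof -
    have "((\<lambda>x. cis (c * x)) has_vector_derivative (\<i> * c) * cis (c * x)) (at x)" for c
    proof -
      have "((\<lambda>z. exp (\<i> * (of_real c * z))) has_field_derivative \<i> * c * cis (c * x)) (at (of_real x))"
        by (rule derivative_eq_intros refl | simp add: cis_conv_exp)+
      from has_vector_derivative_real_field[OF this, of UNIV] show ?thesis
        by (simp add: cis_conv_exp)
    qed
    then show ?thesis unfolding 1
      by (intro has_vector_derivative_sum) (simp only: mult.assoc, intro has_vector_derivative_mult_right)
  qed
  ultimately have 2: "of_real (cos_poly_deriv l P x) = (\<Sum>s<length L. C s * (\<i> * a s) * cis (a s * x))" for x
    by (rule vector_derivative_unique_at)
  from 1 2 show ?thesis by (rule that)
qed

lemma prod_cis: "(\<Prod>k\<in>I. cis (f k)) = cis (\<Sum>k\<in>I. f k)"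
  by (induction I rule: infinite_finite_induct) (simp_all add: cis_mult)

text \<open>Expanding the product over all choices \<open>\<sigma>\<close> of one frequency per
  coordinate leaves single values of the characteristic function; the expectation is therefore an
  explicit function of \<open>K\<close>.\<close>

lemma gaussian_family_expectation_exp_sums:
  assumes G: "gaussian_family M I X K" and I: "finite I" and F: "finite F"
  shows "(\<integral>x. (\<Prod>k\<in>I. \<Sum>s\<in>F. C k s * cis (a s * X k x)) \<partial>M) =
    (\<Sum>\<sigma>\<in>PiE I (\<lambda>_. F). (\<Prod>k\<in>I. C k (\<sigma> k)) *
        of_real (exp (- (\<Sum>i\<in>I. \<Sum>j\<in>I. a (\<sigma> i) * a (\<sigma> j) * K i j) / 2)))"
proof -
  interpret prob_space M using G by (simp add: gaussian_family_def)
  have [measurable]: "X i \<in> borel_measurable M" if "i \<in> I" for i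
    using G that by (simp add: gaussian_family_def)
  have "(\<Prod>k\<in>I. \<Sum>s\<in>F. C k s * cis (a s * X k x)) =
      (\<Sum>\<sigma>\<in>PiE I (\<lambda>_. F). (\<Prod>k\<in>I. C k (\<sigma> k)) * cis (\<Sum>k\<in>I. a (\<sigma> k) * X k x))" for x
    using I F by (subst prod_sum_PiE) (simp_all only: prod.distrib prod_cis)
  then have "(\<integral>x. (\<Prod>k\<in>I. \<Sum>s\<in>F. C k s * cis (a s * X k x)) \<partial>M) =
      (\<integral>x. (\<Sum>\<sigma>\<in>PiE I (\<lambda>_. F). (\<Prod>k\<in>I. C k (\<sigma> k)) * cis (\<Sum>k\<in>I. a (\<sigma> k) * X k x)) \<partial>M)"
    by simp
  also have "\<dots> = (\<Sum>\<sigma>\<in>PiE I (\<lambda>_. F). (\<Prod>k\<in>I. C k (\<sigma> k)) * (\<integral>x. cis (\<Sum>k\<in>I. a (\<sigma> k) * X k x) \<partial>M))"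
  proof (subst Bochner_Integration.integral_sum)
    show "integrable M (\<lambda>x. (\<Prod>k\<in>I. C k (\<sigma> k)) * cis (\<Sum>k\<in>I. a (\<sigma> k) * X k x))" for \<sigma>
      by (intro integrable_mult_right integrable_cis) measurable
  qed simp
  finally show ?thesis by (simp only: gaussian_family_cis[OF G])
qed

lemma gaussian_family_expectation_cos_poly_unique:
  assumes G: "gaussian_family M I X K" and H: "gaussian_family N I Y K" and I: "finite I"
  shows "(\<integral>x. (\<Prod>k\<in>I. cos_poly l P (X k x)) \<partial>M) = (\<integral>x. (\<Prod>k\<in>I. cos_poly l P (Y k x)) \<partial>N)"
proof -
  obtain n :: nat and C a where c: "\<And>x. of_real (cos_poly l P x) = (\<Sum>s<n. C s * cis (a s * x))"
    using cos_poly_eq_exp_sum[of l P] by metis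
  have "complex_of_real (\<integral>x. (\<Prod>k\<in>I. cos_poly l P (X k x)) \<partial>M) = of_real (\<integral>x. (\<Prod>k\<in>I. cos_poly l P (Y k x)) \<partial>N)"
    unfolding integral_complex_of_real[symmetric] of_real_prod c
    by (simp only: gaussian_family_expectation_exp_sums[OF G I finite_lessThan]
        gaussian_family_expectation_exp_sums[OF H I finite_lessThan])
  then show ?thesis by simp
qed

lemma Weierstrass_poly_uniform:
  fixes f :: "real \<Rightarrow> real"
  assumes "continuous_on {a..b} f" "0 < e"
  obtains P where "\<And>x. x \<in> {a..b} \<Longrightarrow> \<bar>poly P x - f x\<bar> < e"
proof -
  obtain g where g: "real_polynomial_function g" "\<And>x. x \<in> {a..b} \<Longrightarrow> \<bar>f x - g x\<bar> < e"
    using Stone_Weierstrass_real_polynomial_function[of "{a..b}" f e] assms by auto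
  obtain c and n :: nat where "g = (\<lambda>x. \<Sum>i\<le>n. c i * x ^ i)"
    using g(1) by (auto simp: real_polynomial_function_iff_sum)
  then have "poly (\<Sum>i\<le>n. monom (c i) i) x = g x" for x
    by (simp add: poly_sum poly_monom)
  with g(2) show ?thesis by (intro that[of "\<Sum>i\<le>n. monom (c i) i"]) (auto simp: abs_minus_commute)
qed

lemma continuous_on_interval_bounded:
  fixes f :: "real \<Rightarrow> real"
  assumes "continuous_on {a..b} f"
  obtains B where "0 < B" "\<And>x. x \<in> {a..b} \<Longrightarrow> \<bar>f x\<bar> \<le> B"
proof -
  obtain B where "0 < B" "\<forall>y\<in>f ` {a..b}. norm y \<le> B"
    using compact_imp_bounded[OF compact_continuous_image[OF assms compact_Icc]]
    unfolding bounded_pos by blast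
  then show ?thesis by (intro that[of B]) auto
qed

text \<open>The absolute value of \<open>cos_poly_deriv\<close> is in general no trigonometric
  polynomial but still a continuous function of the cosine. Uniform approximation on
  \<open>{-1..1}\<close> extends uniqueness to such functions, so that a pair of coordinates can be
  exchanged for an explicit model.\<close>

lemma gaussian_family_expectation_cos_unique:
  fixes f :: "real \<Rightarrow> real"
  assumes G: "gaussian_family M I X K" and H: "gaussian_family N I Y K" and I: "finite I"
    and f: "continuous_on {-1..1} f"
  shows "(\<integral>x. (\<Prod>k\<in>I. f (cos (l * X k x))) \<partial>M) = (\<integral>x. (\<Prod>k\<in>I. f (cos (l * Y k x))) \<partial>N)"
proof -
  have "\<exists>P. \<forall>x\<in>{-1..1}. \<bar>poly P x - f x\<bar> < 1 / (real n + 1)" for n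
  proof -
    have "0 < 1 / (real n + 1)" by simp
    then obtain Q where "\<And>x. x \<in> {-1..1} \<Longrightarrow> \<bar>poly Q x - f x\<bar> < 1 / (real n + 1)"
      using Weierstrass_poly_uniform[OF f] by metis
    then show ?thesis by (intro exI ballI)
  qed
  then obtain P where P: "\<And>n x. x \<in> {-1..1} \<Longrightarrow> \<bar>poly (P n) x - f x\<bar> < 1 / (real n + 1)"
    by metis
  obtain B where B: "0 < B" "\<And>x. x \<in> {-1..1} \<Longrightarrow> \<bar>f x\<bar> \<le> B"
    using continuous_on_interval_bounded[OF f] by blast
  have bd: "\<bar>cos_poly l (P n) x\<bar> \<le> B + 1" for n x
  proof -
    have c: "cos (l * x) \<in> {-1..1}" by simp
    have "1 / (real n + 1) \<le> 1" by simp
    with P[OF c, of n] B(2)[OF c] show ?thesis unfolding cos_poly_def by linarith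
  qed
  have lim: "(\<lambda>n. cos_poly l (P n) x) \<longlonglongrightarrow> f (cos (l * x))" for x
  proof (rule LIM_zero_cancel, rule Lim_null_comparison)
    show "\<forall>\<^sub>F n in sequentially. norm (cos_poly l (P n) x - f (cos (l * x))) \<le> 1 / (real n + 1)"
      unfolding cos_poly_def real_norm_def by (intro always_eventually allI less_imp_le P) simp
    show "(\<lambda>n. 1 / (real n + 1)) \<longlonglongrightarrow> 0"
      using LIMSEQ_inverse_real_of_nat by (simp add: inverse_eq_divide add.commute)
  qed
  have *: "(\<lambda>n. \<integral>x. (\<Prod>k\<in>I. cos_poly l (P n) (Z k x)) \<partial>L) \<longlonglongrightarrow> (\<integral>x. (\<Prod>k\<in>I. f (cos (l * Z k x))) \<partial>L)"
    if "gaussian_family L I Z K" for L :: "'z measure" and Z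
  proof -
    interpret L: prob_space L using that by (simp add: gaussian_family_def)
    have [measurable]: "Z i \<in> borel_measurable L" if "i \<in> I" for i
      using \<open>gaussian_family L I Z K\<close> that by (simp add: gaussian_family_def)
    have m: "(\<lambda>x. f (cos (l * x))) \<in> borel_measurable borel"
      by (intro borel_measurable_continuous_onI continuous_on_compose2[OF f] continuous_intros) auto
    show ?thesis
    proof (rule integral_dominated_convergence[where w = "\<lambda>_. (B + 1) ^ card I"])
      show "AE x in L. norm (\<Prod>k\<in>I. cos_poly l (P n) (Z k x)) \<le> (B + 1) ^ card I" for n
      proof (rule AE_I2)
        fix x
        have "(\<Prod>k\<in>I. norm (cos_poly l (P n) (Z k x))) \<le> (\<Prod>k\<in>I. B + 1)"
          by (intro prod_mono) (simp add: bd)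
        then show "norm (\<Prod>k\<in>I. cos_poly l (P n) (Z k x)) \<le> (B + 1) ^ card I"
          by (simp add: abs_prod)
      qed
      show "AE x in L. (\<lambda>n. \<Prod>k\<in>I. cos_poly l (P n) (Z k x)) \<longlonglongrightarrow> (\<Prod>k\<in>I. f (cos (l * Z k x)))"
        by (intro AE_I2 tendsto_prod lim)
      show "(\<lambda>x. \<Prod>k\<in>I. f (cos (l * Z k x))) \<in> borel_measurable L"
        using m by (intro borel_measurable_prod measurable_compose[of _ L borel "\<lambda>x. f (cos (l * x))"]) auto
      show "(\<lambda>x. \<Prod>k\<in>I. cos_poly l (P n) (Z k x)) \<in> borel_measurable L" for n
        by measurable
    qed simp
  qed
  from *[OF G] *[OF H] show ?thesis
    unfolding gaussian_family_expectation_cos_poly_unique[OF G H I] by (rule LIMSEQ_unique)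
qed

subsection \<open>Bivariate bounds\<close>

text \<open>The right-hand side is the quadratic form of the inverse of the correlation matrix with
  off-diagonal entry \<open>r\<close>; its smallest eigenvalue is
  \<open>1 / (1 + \<bar>r\<bar>)\<close>. The slack \<open>\<rho>\<close> permits one weight for all
  smaller correlations.\<close>

lemma bivariate_quadratic_form_bound:
  fixes x y r \<rho> :: real
  assumes "\<bar>r\<bar> < 1" "\<bar>r\<bar> \<le> \<rho>"
  shows "(x\<^sup>2 + y\<^sup>2) / (1 + \<rho>) \<le> x\<^sup>2 + (y - r * x)\<^sup>2 / (1 - r\<^sup>2)"
proof -
  have r2: "0 < 1 - r\<^sup>2" using assms by (simp add: abs_square_less_1)
  have e: "1 - r\<^sup>2 = (1 - \<bar>r\<bar>) * (1 + \<bar>r\<bar>)" by (simp add: power2_eq_square algebra_simps)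
  have "\<bar>r * (2 * x * y)\<bar> \<le> \<bar>r\<bar> * (x\<^sup>2 + y\<^sup>2)"
    using sum_squares_bound[of "\<bar>x\<bar>" "\<bar>y\<bar>"] by (simp add: abs_mult mult_left_mono mult.assoc)
  then have *: "(1 - \<bar>r\<bar>) * (x\<^sup>2 + y\<^sup>2) \<le> x\<^sup>2 - 2 * r * x * y + y\<^sup>2"
    by (simp add: algebra_simps)
  have "(x\<^sup>2 + y\<^sup>2) / (1 + \<rho>) \<le> (x\<^sup>2 + y\<^sup>2) / (1 + \<bar>r\<bar>)"
    using assms by (intro divide_left_mono mult_pos_pos) auto
  also have "\<dots> = (1 - \<bar>r\<bar>) * (x\<^sup>2 + y\<^sup>2) / (1 - r\<^sup>2)"
    using assms unfolding e by simp
  also have "\<dots> \<le> (x\<^sup>2 - 2 * r * x * y + y\<^sup>2) / (1 - r\<^sup>2)"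
    using * r2 by (intro divide_right_mono) auto
  also have "\<dots> = x\<^sup>2 + (y - r * x)\<^sup>2 / (1 - r\<^sup>2)"
    using r2 by (simp add: field_simps power2_eq_square)
  finally show ?thesis .
qed

text \<open>Up to the factor \<open>1 / sqrt (1 - r\<^sup>2)\<close> the left-hand side is the
  bivariate density, factored into the marginal density of \<open>x\<close> and the conditional
  density of \<open>y\<close> given \<open>x\<close>.\<close>

lemma std_normal_density_mult_le:
  assumes "\<bar>r\<bar> < 1" "\<bar>r\<bar> \<le> \<rho>"
  shows "std_normal_density x * std_normal_density ((y - r * x) / sqrt (1 - r\<^sup>2)) \<le>
     1 / (2 * pi) * (exp (- x\<^sup>2 / (2 * (1 + \<rho>))) * exp (- y\<^sup>2 / (2 * (1 + \<rho>))))"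
proof -
  have r2: "0 < 1 - r\<^sup>2" using assms by (simp add: abs_square_less_1)
  have "- x\<^sup>2 / 2 + - ((y - r * x) / sqrt (1 - r\<^sup>2))\<^sup>2 / 2 = - (x\<^sup>2 + (y - r * x)\<^sup>2 / (1 - r\<^sup>2)) / 2"
    using r2 by (simp add: power_divide field_simps)
  also have "\<dots> \<le> - ((x\<^sup>2 + y\<^sup>2) / (1 + \<rho>)) / 2"
    using bivariate_quadratic_form_bound[OF assms, of x y]
    by (intro divide_right_mono le_imp_neg_le) auto
  also have "\<dots> = - x\<^sup>2 / (2 * (1 + \<rho>)) + - y\<^sup>2 / (2 * (1 + \<rho>))"
    by (simp add: add_divide_distrib diff_divide_distrib mult.commute)
  finally have "exp (- x\<^sup>2 / 2 + - ((y - r * x) / sqrt (1 - r\<^sup>2))\<^sup>2 / 2) \<le> exp (- x\<^sup>2 / (2 * (1 + \<rho>)) + - y\<^sup>2 / (2 * (1 + \<rho>)))"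
    by simp
  then have "1 / (2 * pi) * (exp (- x\<^sup>2 / 2) * exp (- ((y - r * x) / sqrt (1 - r\<^sup>2))\<^sup>2 / 2)) \<le>
      1 / (2 * pi) * (exp (- x\<^sup>2 / (2 * (1 + \<rho>))) * exp (- y\<^sup>2 / (2 * (1 + \<rho>))))"
    unfolding exp_add by (rule mult_left_mono) simp
  then show ?thesis
    by (simp add: std_normal_density_def)
qed

text \<open>Once the density is dominated by a product of weights, the double integral separates
  into two equal integrals, hence the square.\<close>

lemma bivariate_expectation_le:
  fixes \<phi> :: "real \<Rightarrow> real"
  assumes r: "\<bar>r\<bar> < 1" "\<bar>r\<bar> \<le> \<rho>" and [measurable]: "\<phi> \<in> borel_measurable borel"
    and nn: "\<And>x. 0 \<le> \<phi> x" and bd: "\<And>x. \<phi> x \<le> B"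
  shows "(\<integral>(x, y). \<phi> x * \<phi> (r * x + sqrt (1 - r\<^sup>2) * y) \<partial>(std_normal_distribution \<Otimes>\<^sub>M std_normal_distribution))
      \<le> 1 / (2 * pi * sqrt (1 - r\<^sup>2)) * (\<integral>x. \<phi> x * exp (- x\<^sup>2 / (2 * (1 + \<rho>))) \<partial>lborel)\<^sup>2"
proof -
  define s where "s = sqrt (1 - r\<^sup>2)"
  have s: "0 < s" using r by (simp add: s_def abs_square_less_1)
  define w where "w x = exp (- x\<^sup>2 / (2 * (1 + \<rho>)))" for x :: real
  have [measurable]: "w \<in> borel_measurable borel"
    unfolding w_def by measurable
  have w0: "0 \<le> w x" for x by (simp add: w_def)
  have \<rho>: "0 \<le> \<rho>" using r by linarith
  have iw: "integrable lborel w"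
  proof -
    have "w = (\<lambda>x. sqrt (2 * pi * (sqrt (1 + \<rho>))\<^sup>2) * normal_density 0 (sqrt (1 + \<rho>)) x)"
      using \<rho> by (simp add: w_def normal_density_def fun_eq_iff)
    then show ?thesis using \<rho> by simp
  qed
  have ipw: "integrable lborel (\<lambda>x. \<phi> x * w x)"
  proof (rule Bochner_Integration.integrable_bound)
    show "integrable lborel (\<lambda>x. B * w x)" using iw by simp
    have "norm (\<phi> x * w x) \<le> norm (B * w x)" for x
      using nn[of x] bd[of x] w0[of x] by (simp add: abs_mult mult_right_mono)
    then show "AE x in lborel. norm (\<phi> x * w x) \<le> norm (B * w x)" by simp
  qed measurable
  let ?N = std_normal_distribution
  interpret NN: pair_prob_space ?N ?N ..
  \<comment> \<open>The affine substitution makes the second coordinate \<open>r * x + s * y\<close>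
    the integration variable; its Jacobian gives the factor \<open>1 / s\<close>.\<close>
  have inner: "(\<integral>\<^sup>+y. ennreal (\<phi> x * \<phi> (r * x + s * y)) \<partial>?N)
      = (\<integral>\<^sup>+y. ennreal (\<phi> x * \<phi> y * std_normal_density ((y - r * x) / s) / s) \<partial>lborel)" for x
  proof -
    have "(\<integral>\<^sup>+y. ennreal (\<phi> x * \<phi> y * std_normal_density ((y - r * x) / s) / s) \<partial>lborel)
       = s * (\<integral>\<^sup>+y. ennreal (\<phi> x * \<phi> (r * x + s * y) * std_normal_density y / s) \<partial>lborel)"
      using s by (subst nn_integral_real_affine[where c = s and t = "r * x"]) auto
    also have "\<dots> = (\<integral>\<^sup>+y. ennreal s * ennreal (\<phi> x * \<phi> (r * x + s * y) * std_normal_density y / s) \<partial>lborel)"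
      by (subst nn_integral_cmult) auto
    also have "\<dots> = (\<integral>\<^sup>+y. ennreal (std_normal_density y) * ennreal (\<phi> x * \<phi> (r * x + s * y)) \<partial>lborel)"
      using s nn by (intro nn_integral_cong) (simp add: ennreal_mult'[symmetric] mult.commute)
    finally show ?thesis by (simp add: nn_integral_density)
  qed
  define J where "J = ennreal (\<integral>x. \<phi> x * w x \<partial>lborel)"
  have J: "(\<integral>\<^sup>+x. ennreal (\<phi> x * w x) \<partial>lborel) = J"
    using nn w0 ipw unfolding J_def by (intro nn_integral_eq_integral) auto
  have "(\<integral>\<^sup>+z. ennreal (case z of (x, y) \<Rightarrow> \<phi> x * \<phi> (r * x + s * y)) \<partial>(?N \<Otimes>\<^sub>M ?N))
     = (\<integral>\<^sup>+x. (\<integral>\<^sup>+y. ennreal (\<phi> x * \<phi> (r * x + s * y)) \<partial>?N) \<partial>?N)"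
    by (subst std_normal.nn_integral_fst[symmetric]) auto
  also have "\<dots> = (\<integral>\<^sup>+x. ennreal (std_normal_density x) *
       (\<integral>\<^sup>+y. ennreal (\<phi> x * \<phi> y * std_normal_density ((y - r * x) / s) / s) \<partial>lborel) \<partial>lborel)"
    unfolding inner by (subst nn_integral_density) auto
  also have "\<dots> = (\<integral>\<^sup>+x. (\<integral>\<^sup>+y. ennreal (std_normal_density x) *
       ennreal (\<phi> x * \<phi> y * std_normal_density ((y - r * x) / s) / s) \<partial>lborel) \<partial>lborel)"
    by (subst nn_integral_cmult) auto
  also have "\<dots> \<le> (\<integral>\<^sup>+x. (\<integral>\<^sup>+y. ennreal (1 / (2 * pi * s) * (\<phi> x * w x)) * ennreal (\<phi> y * w y) \<partial>lborel) \<partial>lborel)"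
  proof (intro nn_integral_mono)
    fix x y
    have "\<phi> x * \<phi> y / s * (std_normal_density x * std_normal_density ((y - r * x) / s)) \<le>
       \<phi> x * \<phi> y / s * (1 / (2 * pi) * (w x * w y))"
      using std_normal_density_mult_le[OF r, of x y] nn s unfolding s_def w_def
      by (intro mult_left_mono) auto
    then have "std_normal_density x * (\<phi> x * \<phi> y * std_normal_density ((y - r * x) / s) / s)
       \<le> 1 / (2 * pi * s) * (\<phi> x * w x) * (\<phi> y * w y)"
      by (simp add: field_simps)
    then show "ennreal (std_normal_density x) * ennreal (\<phi> x * \<phi> y * std_normal_density ((y - r * x) / s) / s)
       \<le> ennreal (1 / (2 * pi * s) * (\<phi> x * w x)) * ennreal (\<phi> y * w y)"
      using nn s w0 by (simp add: ennreal_mult'[symmetric] ennreal_leI)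
  qed
  also have "\<dots> = (\<integral>\<^sup>+x. ennreal (1 / (2 * pi * s)) * ennreal (\<phi> x * w x) * J \<partial>lborel)"
    using s by (subst nn_integral_cmult) (auto simp: J ennreal_mult'[symmetric] intro!: nn_integral_cong)
  also have "\<dots> = ennreal (1 / (2 * pi * s)) * (ennreal (\<integral>x. \<phi> x * w x \<partial>lborel) * ennreal (\<integral>x. \<phi> x * w x \<partial>lborel))"
    by (subst nn_integral_multc) (simp_all add: nn_integral_cmult J J_def mult.assoc)
  also have "\<dots> = ennreal (1 / (2 * pi * s) * (\<integral>x. \<phi> x * w x \<partial>lborel)\<^sup>2)"
    using nn w0 s by (simp add: ennreal_mult'[symmetric] power2_eq_square integral_nonneg_AE)
  finally have "(\<integral>\<^sup>+z. ennreal (case z of (x, y) \<Rightarrow> \<phi> x * \<phi> (r * x + s * y)) \<partial>(?N \<Otimes>\<^sub>M ?N))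
     \<le> ennreal (1 / (2 * pi * s) * (\<integral>x. \<phi> x * w x \<partial>lborel)\<^sup>2)" .
  then have "(\<integral>(x, y). \<phi> x * \<phi> (r * x + s * y) \<partial>(?N \<Otimes>\<^sub>M ?N)) \<le> 1 / (2 * pi * s) * (\<integral>x. \<phi> x * w x \<partial>lborel)\<^sup>2"
    using nn s by (intro integral_real_bounded) auto
  then show ?thesis unfolding s_def w_def .
qed

text \<open>The Cholesky factor of the 2 x 2 correlation matrix turns two independent standard
  normals into a pair with correlation \<open>r\<close>.\<close>

lemma gaussian_family_bivariate:
  assumes ij: "i \<noteq> j" and r: "\<bar>r\<bar> \<le> 1" and K: "K i i = 1" "K j j = 1" "K i j = r" "K j i = r"
  shows "gaussian_family (std_normal_distribution \<Otimes>\<^sub>M std_normal_distribution) {i, j}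
     (\<lambda>k (x, y). if k = i then x else r * x + sqrt (1 - r\<^sup>2) * y) K"
proof -
  let ?N = std_normal_distribution
  interpret NN: pair_prob_space ?N ?N ..
  define s where "s = sqrt (1 - r\<^sup>2)"
  have s2: "s\<^sup>2 = 1 - r\<^sup>2" using r by (simp add: s_def abs_square_le_1)
  have "(\<integral>z. cis (\<Sum>k\<in>{i, j}. c k * (case z of (x, y) \<Rightarrow> if k = i then x else r * x + s * y)) \<partial>(?N \<Otimes>\<^sub>M ?N))
      = of_real (exp (- (\<Sum>k\<in>{i, j}. \<Sum>m\<in>{i, j}. c k * c m * K k m) / 2))" for c
  proof -
    have "(\<integral>z. cis (\<Sum>k\<in>{i, j}. c k * (case z of (x, y) \<Rightarrow> if k = i then x else r * x + s * y)) \<partial>(?N \<Otimes>\<^sub>M ?N))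
       = (\<integral>z. cis (case z of (x, y) \<Rightarrow> c i * x + c j * (r * x + s * y)) \<partial>(?N \<Otimes>\<^sub>M ?N))"
      using ij by (intro Bochner_Integration.integral_cong) auto
    also have "\<dots> = (\<integral>x. (\<integral>y. cis (c i * x + c j * (r * x + s * y)) \<partial>?N) \<partial>?N)"
      by (subst NN.integral_fst'[symmetric]) (auto intro!: NN.P.integrable_cis)
    also have "\<dots> = (\<integral>x. (\<integral>y. cis ((c i + c j * r) * x) * cis ((c j * s) * y) \<partial>?N) \<partial>?N)"
      by (simp add: cis_mult algebra_simps)
    also have "\<dots> = of_real (exp (- (c i + c j * r)\<^sup>2 / 2)) * of_real (exp (- (c j * s)\<^sup>2 / 2))"
      by (simp only: integral_cis_std_normal Bochner_Integration.integral_mult_right_zero integral_mult_left_zero)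
    also have "\<dots> = of_real (exp (- (c i + c j * r)\<^sup>2 / 2 + - (c j * s)\<^sup>2 / 2))"
      by (simp only: exp_add of_real_mult)
    also have "- (c i + c j * r)\<^sup>2 / 2 + - (c j * s)\<^sup>2 / 2 = - (\<Sum>k\<in>{i, j}. \<Sum>m\<in>{i, j}. c k * c m * K k m) / 2"
      unfolding power_mult_distrib s2 using ij by (simp add: K power2_eq_square field_simps)
    finally show ?thesis .
  qed
  then show ?thesis
    unfolding gaussian_family_def s_def by (auto simp: NN.P.prob_space_axioms case_prod_unfold)
qed

text \<open>Only the pair of coordinates \<open>i\<close>, \<open>j\<close> is replaced by a model
  with a density, which exists because \<open>\<bar>K i j\<bar> < 1\<close>; the matrix
  \<open>K\<close> as a whole may be singular.\<close>

lemma gaussian_family_pair_expectation_le: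
  fixes f :: "real \<Rightarrow> real"
  assumes G: "gaussian_family M I X K" "finite I" and ij: "i \<in> I" "j \<in> I" "i \<noteq> j"
    and K: "K i i = 1" "K j j = 1" "K j i = K i j" and r: "\<bar>K i j\<bar> < 1" "\<bar>K i j\<bar> \<le> \<rho>"
    and f: "continuous_on {-1..1} f" "\<And>x. 0 \<le> f x"
  shows "(\<integral>x. f (cos (l * X i x)) * f (cos (l * X j x)) \<partial>M)
    \<le> 1 / (2 * pi * sqrt (1 - (K i j)\<^sup>2)) * (\<integral>x. f (cos (l * x)) * exp (- x\<^sup>2 / (2 * (1 + \<rho>))) \<partial>lborel)\<^sup>2"
proof -
  let ?Y = "\<lambda>k (x, y). if k = i then x else K i j * x + sqrt (1 - (K i j)\<^sup>2) * y"
  obtain B where B: "\<And>x. x \<in> {-1..1} \<Longrightarrow> \<bar>f x\<bar> \<le> B"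
    using continuous_on_interval_bounded[OF f(1)] by blast
  have G2: "gaussian_family M {i, j} X K"
    by (rule gaussian_family_mono[OF G(1)]) (use G ij in auto)
  have H: "gaussian_family (std_normal_distribution \<Otimes>\<^sub>M std_normal_distribution) {i, j} ?Y K"
    by (rule gaussian_family_bivariate) (use K ij r in auto)
  have "(\<integral>x. f (cos (l * X i x)) * f (cos (l * X j x)) \<partial>M) = (\<integral>x. (\<Prod>k\<in>{i, j}. f (cos (l * X k x))) \<partial>M)"
    using ij by simp
  also have "\<dots> = (\<integral>x. (\<Prod>k\<in>{i, j}. f (cos (l * ?Y k x))) \<partial>(std_normal_distribution \<Otimes>\<^sub>M std_normal_distribution))"
    by (rule gaussian_family_expectation_cos_unique[OF G2 H _ f(1)]) simp
  also have "\<dots> = (\<integral>(x, y). f (cos (l * x)) * f (cos (l * (K i j * x + sqrt (1 - (K i j)\<^sup>2) * y)))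
       \<partial>(std_normal_distribution \<Otimes>\<^sub>M std_normal_distribution))"
    using ij by (intro Bochner_Integration.integral_cong) auto
  also have "\<dots> \<le> 1 / (2 * pi * sqrt (1 - (K i j)\<^sup>2)) * (\<integral>x. f (cos (l * x)) * exp (- x\<^sup>2 / (2 * (1 + \<rho>))) \<partial>lborel)\<^sup>2"
  proof (rule bivariate_expectation_le[OF r])
    show "(\<lambda>x. f (cos (l * x))) \<in> borel_measurable borel"
      by (intro borel_measurable_continuous_onI continuous_on_compose2[OF f(1)] continuous_intros) auto
    show "f (cos (l * x)) \<le> B" for x using B[of "cos (l * x)"] by auto
  qed (use f in auto)
  finally show ?thesis .
qed

subsection \<open>The comparison inequality for trigonometric polynomials\<close>

text \<open>The remaining \<open>card I - 2\<close> factors are bounded by \<open>B\<close>, and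
  \<open>1 \<le> B\<close> permits rounding the exponent up to \<open>card I\<close>. Nothing is
  lost in the end, since \<open>B\<close> will tend to 1.\<close>

lemma abs_prod_two_factors_le:
  fixes f g :: "'i \<Rightarrow> real"
  assumes I: "finite I" "i \<in> I" "j \<in> I" "i \<noteq> j" and B: "1 \<le> B" "\<And>k. k \<in> I \<Longrightarrow> \<bar>f k\<bar> \<le> B"
  shows "\<bar>\<Prod>k\<in>I. if k = i \<or> k = j then g k else f k\<bar> \<le> B ^ card I * (\<bar>g i\<bar> * \<bar>g j\<bar>)"
proof -
  have "(\<Prod>k\<in>I. if k = i \<or> k = j then g k else f k) = (\<Prod>k\<in>{i, j}. if k = i \<or> k = j then g k else f k) *
      (\<Prod>k\<in>I - {i, j}. if k = i \<or> k = j then g k else f k)"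
    using I by (intro prod.subset_diff[of "{i, j}" I, THEN trans] mult.commute) auto
  also have "(\<Prod>k\<in>I - {i, j}. if k = i \<or> k = j then g k else f k) = (\<Prod>k\<in>I - {i, j}. f k)"
    by (intro prod.cong) auto
  also have "(\<Prod>k\<in>{i, j}. if k = i \<or> k = j then g k else f k) = g i * g j"
    using I by simp
  finally have "\<bar>\<Prod>k\<in>I. if k = i \<or> k = j then g k else f k\<bar> = \<bar>g i\<bar> * \<bar>g j\<bar> * (\<Prod>k\<in>I - {i, j}. \<bar>f k\<bar>)"
    by (simp add: abs_mult abs_prod)
  moreover have "(\<Prod>k\<in>I - {i, j}. \<bar>f k\<bar>) \<le> (\<Prod>k\<in>I - {i, j}. B)"
    using B by (intro prod_mono) auto
  moreover have "(\<Prod>k\<in>I - {i, j}. B) \<le> B ^ card I"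
    using B I by (simp add: power_increasing card_Diff_subset)
  ultimately show ?thesis
    by (metis abs_ge_zero mult.commute mult_left_mono mult_nonneg_nonneg order_trans)
qed

lemma cos_poly_bounded:
  obtains B where "\<And>x. \<bar>cos_poly l P x\<bar> \<le> B" "\<And>x. \<bar>cos_poly_deriv l P x\<bar> \<le> B"
proof -
  have "continuous_on {-1..1} (poly P)" "continuous_on {-1..1} (poly (pderiv P))"
    by (intro continuous_intros)+
  note c = this
  obtain B where B: "0 < B" "\<And>x. x \<in> {-1..1} \<Longrightarrow> \<bar>poly P x\<bar> \<le> B"
    using continuous_on_interval_bounded[OF c(1)] by blast
  obtain C where C: "0 < C" "\<And>x. x \<in> {-1..1} \<Longrightarrow> \<bar>poly (pderiv P) x\<bar> \<le> C"
    using continuous_on_interval_bounded[OF c(2)] by blast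
  have "\<bar>cos_poly l P x\<bar> \<le> B" for x
    using B(2)[of "cos (l * x)"] by (simp add: cos_poly_def)
  moreover have "\<bar>cos_poly_deriv l P x\<bar> \<le> \<bar>l\<bar> * 1 * C" for x
    unfolding cos_poly_deriv_def abs_minus_cancel abs_mult
    using C(2)[of "cos (l * x)"] C(1) by (intro mult_mono) auto
  ultimately show ?thesis by (intro that[of "max B (\<bar>l\<bar> * 1 * C)"]) (auto simp: le_max_iff_disj)
qed

text \<open>Differentiating along the interpolation between two Gaussian covariances, Plackett's identity
  produces the mixed second derivatives of the test function; for products of exponential sums it is
  a finite identity.\<close>

lemma gaussian_interpolation_derivative:
  fixes I :: "'i set"
  assumes I: "finite I"
    and G: "\<And>t. t \<in> {0..1} \<Longrightarrow> gaussian_family (N t) I (Y t) (\<lambda>i j. t * K i j + (1 - t) * L i j)"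
    and KL: "\<And>i. i \<in> I \<Longrightarrow> K i i = L i i"
  obtains \<Psi> :: "real \<Rightarrow> complex" where
    "\<And>t. t \<in> {0..1} \<Longrightarrow> \<Psi> t = of_real (\<integral>x. (\<Prod>k\<in>I. cos_poly l P (Y t k x)) \<partial>N t)"
    "\<And>t. t \<in> {0..1} \<Longrightarrow> (\<Psi> has_vector_derivative (\<Sum>i\<in>I. \<Sum>j\<in>I. of_real ((K i j - L i j) / 2) *
        of_real (\<integral>x. (\<Prod>k\<in>I. if k = i \<or> k = j then cos_poly_deriv l P (Y t k x)
                 else cos_poly l P (Y t k x)) \<partial>N t))) (at t)"
proof -
  obtain n :: nat and C a where c: "\<And>x. of_real (cos_poly l P x) = (\<Sum>s<n. C s * cis (a s * x))"
    and c': "\<And>x. of_real (cos_poly_deriv l P x) = (\<Sum>s<n. C s * (\<i> * a s) * cis (a s * x))"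
    by (rule cos_poly_eq_exp_sum[of l P]) (rule that)
  define S where "S = PiE I (\<lambda>_. {..<n})"
  define Q where "Q t \<sigma> = (\<Sum>i\<in>I. \<Sum>j\<in>I. a (\<sigma> i) * a (\<sigma> j) * (t * K i j + (1 - t) * L i j))" for t \<sigma>
  define R where "R \<sigma> = (\<Sum>i\<in>I. \<Sum>j\<in>I. a (\<sigma> i) * a (\<sigma> j) * (K i j - L i j))" for \<sigma>
  define E where "E t \<sigma> = complex_of_real (exp (- Q t \<sigma> / 2))" for t \<sigma>
  define \<Psi> where "\<Psi> t = (\<Sum>\<sigma>\<in>S. (\<Prod>k\<in>I. C (\<sigma> k)) * E t \<sigma>)" for t
  have \<Psi>: "\<Psi> t = of_real (\<integral>x. (\<Prod>k\<in>I. cos_poly l P (Y t k x)) \<partial>N t)" if "t \<in> {0..1}" for t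
    unfolding integral_complex_of_real[symmetric] of_real_prod c
    unfolding gaussian_family_expectation_exp_sums[OF G[OF that] I finite_lessThan, of "\<lambda>k. C" a]
    unfolding \<Psi>_def S_def E_def Q_def ..
  \<comment> \<open>Two differentiated factors contribute \<open>\<i> * a (\<sigma> i)\<close> and
    \<open>\<i> * a (\<sigma> j)\<close>, whose product is
    \<open>- (a (\<sigma> i) * a (\<sigma> j))\<close>. Times half of \<open>K i j - L i j\<close>,
    this is the (i, j) part of the t-derivative of the exponent, which is affine in t.\<close>
  have D: "of_real ((K i j - L i j) / 2) *
        of_real (\<integral>x. (\<Prod>k\<in>I. if k = i \<or> k = j then cos_poly_deriv l P (Y t k x)
                 else cos_poly l P (Y t k x)) \<partial>N t) =
      (\<Sum>\<sigma>\<in>S. (\<Prod>k\<in>I. C (\<sigma> k)) * (E t \<sigma> * of_real (- (a (\<sigma> i) * a (\<sigma> j) * (K i j - L i j)) / 2)))"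
    if t: "t \<in> {0..1}" and ij: "i \<in> I" "j \<in> I" for t i j
  \<comment> \<open>On the diagonal the product contains one first derivative instead of a second
    derivative, but the prefactor vanishes there by \<open>KL\<close>.\<close>
  proof (cases "i = j")
    case True
    then show ?thesis using KL ij by simp
  next
    case False
    have "complex_of_real (\<Prod>k\<in>I. if k = i \<or> k = j then cos_poly_deriv l P (Y t k x) else cos_poly l P (Y t k x)) =
      (\<Prod>k\<in>I. \<Sum>s<n. (if k = i \<or> k = j then C s * (\<i> * a s) else C s) * cis (a s * Y t k x))" for x
      unfolding of_real_prod by (intro prod.cong refl) (simp add: c c')
    then have "complex_of_real (\<integral>x. (\<Prod>k\<in>I. if k = i \<or> k = j then cos_poly_deriv l P (Y t k x)
                 else cos_poly l P (Y t k x)) \<partial>N t) =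
      (\<integral>x. (\<Prod>k\<in>I. \<Sum>s<n. (if k = i \<or> k = j then C s * (\<i> * a s) else C s) * cis (a s * Y t k x)) \<partial>N t)"
      unfolding integral_complex_of_real[symmetric] by simp
    also have "\<dots> = (\<Sum>\<sigma>\<in>S. (\<Prod>k\<in>I. if k = i \<or> k = j then C (\<sigma> k) * (\<i> * a (\<sigma> k)) else C (\<sigma> k)) * E t \<sigma>)"
      unfolding S_def E_def Q_def
      by (rule gaussian_family_expectation_exp_sums[OF G[OF t] I finite_lessThan,
            of "\<lambda>k s. if k = i \<or> k = j then C s * (\<i> * a s) else C s" a])
    also have "\<dots> = (\<Sum>\<sigma>\<in>S. (\<Prod>k\<in>I. C (\<sigma> k)) * (- (a (\<sigma> i) * a (\<sigma> j))) * E t \<sigma>)"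
    proof (intro sum.cong refl arg_cong2[where f = "(*)"])
      fix \<sigma>
      have "(\<Prod>k\<in>I. if k = i \<or> k = j then C (\<sigma> k) * (\<i> * a (\<sigma> k)) else C (\<sigma> k)) =
        (\<Prod>k\<in>I. C (\<sigma> k) * (if k \<in> {i, j} then \<i> * a (\<sigma> k) else 1))"
        by (intro prod.cong) auto
      also have "\<dots> = (\<Prod>k\<in>I. C (\<sigma> k)) * (\<Prod>k\<in>I \<inter> {i, j}. \<i> * a (\<sigma> k))"
        using I by (subst prod.distrib) (simp add: prod.inter_restrict)
      also have "I \<inter> {i, j} = {i, j}" using ij by auto
      finally show "(\<Prod>k\<in>I. if k = i \<or> k = j then C (\<sigma> k) * (\<i> * a (\<sigma> k)) else C (\<sigma> k)) =
        (\<Prod>k\<in>I. C (\<sigma> k)) * (- (a (\<sigma> i) * a (\<sigma> j)))"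
        using False by (simp add: algebra_simps)
    qed
    finally show ?thesis
      by (simp only: sum_distrib_left) (intro sum.cong refl, simp add: field_simps)
  qed
  have "(\<Psi> has_vector_derivative (\<Sum>i\<in>I. \<Sum>j\<in>I. of_real ((K i j - L i j) / 2) *
        of_real (\<integral>x. (\<Prod>k\<in>I. if k = i \<or> k = j then cos_poly_deriv l P (Y t k x)
                 else cos_poly l P (Y t k x)) \<partial>N t))) (at t)" if t: "t \<in> {0..1}" for t
  proof -
    have "((\<lambda>t. Q t \<sigma>) has_real_derivative R \<sigma>) (at t)" for \<sigma>
    proof -
      have "((\<lambda>t. t * K i j + (1 - t) * L i j) has_real_derivative K i j - L i j) (at t)" for i j
        by (auto intro!: derivative_eq_intros)
      then show ?thesis
        unfolding Q_def R_def by (intro DERIV_sum DERIV_cmult)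
    qed
    then have "((\<lambda>t. exp (- Q t \<sigma> / 2)) has_real_derivative exp (- Q t \<sigma> / 2) * (- R \<sigma> / 2)) (at t)" for \<sigma>
      by (auto intro!: derivative_eq_intros)
    then have "((\<lambda>t. E t \<sigma>) has_vector_derivative of_real (exp (- Q t \<sigma> / 2) * (- R \<sigma> / 2))) (at t)" for \<sigma>
      unfolding E_def by (intro has_vector_derivative_of_real) (simp add: has_real_derivative_iff_has_vector_derivative)
    then have "(\<Psi> has_vector_derivative (\<Sum>\<sigma>\<in>S. (\<Prod>k\<in>I. C (\<sigma> k)) * of_real (exp (- Q t \<sigma> / 2) * (- R \<sigma> / 2)))) (at t)"
      unfolding \<Psi>_def by (intro has_vector_derivative_sum has_vector_derivative_mult_right)
    also have "(\<Sum>\<sigma>\<in>S. (\<Prod>k\<in>I. C (\<sigma> k)) * of_real (exp (- Q t \<sigma> / 2) * (- R \<sigma> / 2))) =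
       (\<Sum>\<sigma>\<in>S. \<Sum>i\<in>I. \<Sum>j\<in>I. (\<Prod>k\<in>I. C (\<sigma> k)) * (E t \<sigma> * of_real (- (a (\<sigma> i) * a (\<sigma> j) * (K i j - L i j)) / 2)))"
    proof (intro sum.cong refl)
      fix \<sigma>
      have "- R \<sigma> / 2 = (\<Sum>i\<in>I. \<Sum>j\<in>I. - (a (\<sigma> i) * a (\<sigma> j) * (K i j - L i j)) / 2)"
        by (simp add: R_def sum_divide_distrib sum_negf)
      then show "(\<Prod>k\<in>I. C (\<sigma> k)) * of_real (exp (- Q t \<sigma> / 2) * (- R \<sigma> / 2)) =
        (\<Sum>i\<in>I. \<Sum>j\<in>I. (\<Prod>k\<in>I. C (\<sigma> k)) * (E t \<sigma> * of_real (- (a (\<sigma> i) * a (\<sigma> j) * (K i j - L i j)) / 2)))"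
        by (simp only: E_def of_real_mult of_real_sum sum_distrib_left)
    qed
    also have "\<dots> = (\<Sum>i\<in>I. \<Sum>j\<in>I. \<Sum>\<sigma>\<in>S. (\<Prod>k\<in>I. C (\<sigma> k)) * (E t \<sigma> * of_real (- (a (\<sigma> i) * a (\<sigma> j) * (K i j - L i j)) / 2)))"
      by (subst sum.swap) (intro sum.cong refl sum.swap)
    also have "\<dots> = (\<Sum>i\<in>I. \<Sum>j\<in>I. of_real ((K i j - L i j) / 2) *
        of_real (\<integral>x. (\<Prod>k\<in>I. if k = i \<or> k = j then cos_poly_deriv l P (Y t k x)
                 else cos_poly l P (Y t k x)) \<partial>N t))"
      using t by (intro sum.cong refl) (simp only: D)
    finally show ?thesis .
  qed
  with \<Psi> show ?thesis by (rule that)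
qed

text \<open>The interpolation path runs from independent standard normals at t = 0 to
  \<open>K\<close> at t = 1, with unit variances throughout. The factor 1/8 is 1/2 times 1/(2 pi)
  times arcsin 1.\<close>

lemma gaussian_comparison_cos_poly:
  fixes I :: "'i set"
  assumes G: "gaussian_family M I X K" and I: "finite I"
    and K1: "\<And>i. i \<in> I \<Longrightarrow> K i i = 1" and Ks: "\<And>i j. i \<in> I \<Longrightarrow> j \<in> I \<Longrightarrow> K i j = K j i"
    and Kle: "\<And>i j. i \<in> I \<Longrightarrow> j \<in> I \<Longrightarrow> \<bar>K i j\<bar> \<le> 1"
    and B: "1 \<le> B" "\<And>x. \<bar>cos_poly l P x\<bar> \<le> B"
  shows "\<bar>(\<integral>x. (\<Prod>k\<in>I. cos_poly l P (X k x)) \<partial>M) - (\<integral>x. cos_poly l P x \<partial>std_normal_distribution) ^ card I\<bar>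
    \<le> B ^ card I / 8 * (\<Sum>i\<in>I. \<Sum>j\<in>I - {i}. \<bar>K i j\<bar> *
         (\<integral>x. \<bar>cos_poly_deriv l P x\<bar> * exp (- x\<^sup>2 / (2 * (1 + \<bar>K i j\<bar>))) \<partial>lborel)\<^sup>2)"
proof -
  define L where "L i j = (if i = j then 1 else 0 :: real)" for i j :: 'i
  let ?Z = "Pi\<^sub>M I (\<lambda>_. std_normal_distribution)"
  let ?N = "M \<Otimes>\<^sub>M ?Z"
  let ?Y = "\<lambda>t i (x, y). sqrt t * X i x + sqrt (1 - t) * y i"
  \<comment> \<open>The weight uses the final correlation \<open>\<bar>K i j\<bar>\<close> instead
    of \<open>t * \<bar>K i j\<bar>\<close>, which makes \<open>V\<close> constant in t.\<close>
  define V where "V i j = (\<integral>x. \<bar>cos_poly_deriv l P x\<bar> * exp (- x\<^sup>2 / (2 * (1 + \<bar>K i j\<bar>))) \<partial>lborel)\<^sup>2" for i j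
  define A where "A = B ^ card I / (4 * pi) * (\<Sum>i\<in>I. \<Sum>j\<in>I - {i}. \<bar>K i j\<bar> * V i j)"
  have GZ: "gaussian_family ?Z I (\<lambda>i y. y i) L"
    using gaussian_family_iid[OF I] unfolding L_def .
  have GY: "gaussian_family ?N I (?Y t) (\<lambda>i j. t * K i j + (1 - t) * L i j)" if "t \<in> {0..1}" for t
    using gaussian_family_interpolate[OF G GZ, of t] that by simp
  interpret Z: product_prob_space "\<lambda>_. std_normal_distribution" I by unfold_locales
  interpret M: prob_space M using G by (simp add: gaussian_family_def)
  interpret MZ: pair_prob_space M ?Z ..
  have [measurable]: "X i \<in> borel_measurable M" if "i \<in> I" for i
    using G that by (simp add: gaussian_family_def)
  obtain \<Psi> where \<Psi>: "\<And>t. t \<in> {0..1} \<Longrightarrow> \<Psi> t = complex_of_real (\<integral>x. (\<Prod>k\<in>I. cos_poly l P (?Y t k x)) \<partial>?N)"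
    and \<Psi>': "\<And>t. t \<in> {0..1} \<Longrightarrow> (\<Psi> has_vector_derivative (\<Sum>i\<in>I. \<Sum>j\<in>I. of_real ((K i j - L i j) / 2) *
        of_real (\<integral>x. (\<Prod>k\<in>I. if k = i \<or> k = j then cos_poly_deriv l P (?Y t k x)
                 else cos_poly l P (?Y t k x)) \<partial>?N))) (at t)"
    by (rule gaussian_interpolation_derivative[OF I GY, where l = l and P = P]) (use K1 in \<open>auto simp: L_def\<close>)
  obtain B' where B': "\<And>x. \<bar>cos_poly_deriv l P x\<bar> \<le> B'"
    using cos_poly_bounded[of l P] by metis
  have summand: "\<bar>(K i j - L i j) / 2 * (\<integral>x. (\<Prod>k\<in>I. if k = i \<or> k = j then cos_poly_deriv l P (?Y t k x)
                 else cos_poly l P (?Y t k x)) \<partial>?N)\<bar> \<le>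
      (if j = i then 0 else B ^ card I / (4 * pi) * (\<bar>K i j\<bar> * V i j) * (1 / sqrt (1 - t\<^sup>2)))"
    if t: "0 < t" "t < 1" and ij: "i \<in> I" "j \<in> I" for i j t
  proof (cases "j = i")
    case True
    then show ?thesis using ij K1 by (simp add: L_def)
  next
    case False
    have [measurable]: "?Y t k \<in> borel_measurable ?N" if "k \<in> I" for k
      using that by measurable
    have "\<bar>\<integral>x. (\<Prod>k\<in>I. if k = i \<or> k = j then cos_poly_deriv l P (?Y t k x) else cos_poly l P (?Y t k x)) \<partial>?N\<bar>
      \<le> (\<integral>x. B ^ card I * (\<bar>cos_poly_deriv l P (?Y t i x)\<bar> * \<bar>cos_poly_deriv l P (?Y t j x)\<bar>) \<partial>?N)"
    proof (rule integral_abs_bound[THEN order_trans], rule integral_mono')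
      show "integrable ?N (\<lambda>x. B ^ card I * (\<bar>cos_poly_deriv l P (?Y t i x)\<bar> * \<bar>cos_poly_deriv l P (?Y t j x)\<bar>))"
      proof (rule MZ.P.integrable_const_bound[where B = "B ^ card I * (B' * B')"])
        have "0 \<le> B'" using B'[of 0] by linarith
        then show "AE x in ?N. norm (B ^ card I * (\<bar>cos_poly_deriv l P (?Y t i x)\<bar> * \<bar>cos_poly_deriv l P (?Y t j x)\<bar>))
          \<le> B ^ card I * (B' * B')"
          using B by (intro AE_I2) (auto simp: abs_mult intro!: mult_left_mono mult_mono B')
        show "(\<lambda>x. B ^ card I * (\<bar>cos_poly_deriv l P (?Y t i x)\<bar> * \<bar>cos_poly_deriv l P (?Y t j x)\<bar>)) \<in> borel_measurable ?N"
          using ij by measurable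
      qed
      show "\<bar>\<Prod>k\<in>I. if k = i \<or> k = j then cos_poly_deriv l P (?Y t k x) else cos_poly l P (?Y t k x)\<bar>
        \<le> B ^ card I * (\<bar>cos_poly_deriv l P (?Y t i x)\<bar> * \<bar>cos_poly_deriv l P (?Y t j x)\<bar>)" for x
        by (rule abs_prod_two_factors_le[OF I ij False[symmetric] B(1), of "\<lambda>k. cos_poly l P (?Y t k x)"
            "\<lambda>k. cos_poly_deriv l P (?Y t k x)"]) (rule B(2))
    qed (use B in auto)
    also have "\<dots> = B ^ card I * (\<integral>x. \<bar>cos_poly_deriv l P (?Y t i x)\<bar> * \<bar>cos_poly_deriv l P (?Y t j x)\<bar> \<partial>?N)"
      by simp
    also have "(\<integral>x. \<bar>cos_poly_deriv l P (?Y t i x)\<bar> * \<bar>cos_poly_deriv l P (?Y t j x)\<bar> \<partial>?N)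
       \<le> 1 / (2 * pi * sqrt (1 - (t * K i j)\<^sup>2)) * V i j"
    proof -
      have s: "\<bar>sin (l * x)\<bar> = sqrt (1 - (cos (l * x))\<^sup>2)" for x
        using sin_cos_squared_add[of "l * x"] by (simp add: sin_squared_eq[symmetric])
      \<comment> \<open>The absolute value inside the root keeps this function of the cosine
        nonnegative outside \<open>{-1..1}\<close> as well, where \<open>sqrt\<close> would have a
        negative argument and a negative value.\<close>
      have d: "\<bar>cos_poly_deriv l P x\<bar> = (\<lambda>y. \<bar>l\<bar> * sqrt \<bar>1 - y\<^sup>2\<bar> * \<bar>poly (pderiv P) y\<bar>) (cos (l * x))" for x
        by (simp add: cos_poly_deriv_def abs_mult s abs_square_le_1)
      \<comment> \<open>Since t < 1, the interpolated correlation stays strictly below one in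
        modulus even if \<open>\<bar>K i j\<bar> = 1\<close>, so the bivariate density
        exists.\<close>
      have "t * \<bar>K i j\<bar> \<le> t * 1" "t * \<bar>K i j\<bar> \<le> 1 * \<bar>K i j\<bar>"
        using t Kle[OF ij] by (intro mult_left_mono mult_right_mono; simp)+
      then have tK: "\<bar>t * K i j\<bar> < 1" "\<bar>t * K i j\<bar> \<le> \<bar>K i j\<bar>"
        using t by (simp_all only: abs_mult abs_of_pos mult_1_right mult_1_left)
      let ?g = "\<lambda>y. \<bar>l\<bar> * sqrt \<bar>1 - y\<^sup>2\<bar> * \<bar>poly (pderiv P) y\<bar>"
      have L: "L i j = 0" "L j i = 0" "L i i = 1" "L j j = 1" using False by (auto simp: L_def)
      have "(\<integral>x. ?g (cos (l * ?Y t i x)) * ?g (cos (l * ?Y t j x)) \<partial>?N)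
        \<le> 1 / (2 * pi * sqrt (1 - (t * K i j + (1 - t) * L i j)\<^sup>2)) *
          (\<integral>x. ?g (cos (l * x)) * exp (- x\<^sup>2 / (2 * (1 + \<bar>K i j\<bar>))) \<partial>lborel)\<^sup>2"
      proof (rule gaussian_family_pair_expectation_le[OF GY I ij False[symmetric]])
        show "t * K j i + (1 - t) * L j i = t * K i j + (1 - t) * L i j"
          by (simp only: L Ks[OF ij])
        show "continuous_on {-1..1} ?g" by (intro continuous_intros)
      qed (use t tK ij K1 in \<open>simp_all add: L\<close>)
      then show ?thesis unfolding V_def d by (simp only: L mult_zero_right add_0_right)
    qed
    also have "\<dots> \<le> 1 / (2 * pi) * V i j * (1 / sqrt (1 - t\<^sup>2))"
    proof -
      have "(t * K i j)\<^sup>2 \<le> t\<^sup>2"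
        using Kle[OF ij] by (simp add: power_mult_distrib abs_square_le_1 mult_left_le)
      moreover have t2: "t\<^sup>2 < 1" using t by (simp add: abs_square_less_1)
      ultimately have "1 / sqrt (1 - (t * K i j)\<^sup>2) \<le> 1 / sqrt (1 - t\<^sup>2)"
        using t2 by (intro divide_left_mono mult_pos_pos) auto
      then have "1 / (2 * pi) * V i j * (1 / sqrt (1 - (t * K i j)\<^sup>2)) \<le> 1 / (2 * pi) * V i j * (1 / sqrt (1 - t\<^sup>2))"
        by (intro mult_left_mono) (auto simp: V_def)
      then show ?thesis by simp
    qed
    finally have "\<bar>\<integral>x. (\<Prod>k\<in>I. if k = i \<or> k = j then cos_poly_deriv l P (?Y t k x) else cos_poly l P (?Y t k x)) \<partial>?N\<bar>
       \<le> B ^ card I * (1 / (2 * pi) * V i j * (1 / sqrt (1 - t\<^sup>2)))"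
      using B by (simp add: mult_left_mono)
    then have "\<bar>K i j / 2\<bar> * \<bar>\<integral>x. (\<Prod>k\<in>I. if k = i \<or> k = j then cos_poly_deriv l P (?Y t k x) else cos_poly l P (?Y t k x)) \<partial>?N\<bar>
       \<le> \<bar>K i j / 2\<bar> * (B ^ card I * (1 / (2 * pi) * V i j * (1 / sqrt (1 - t\<^sup>2))))"
      by (rule mult_left_mono) simp
    then show ?thesis using False unfolding abs_mult by (simp add: L_def abs_mult)
  qed
  txt \<open>The majorant \<open>1 / sqrt (1 - t\<^sup>2)\<close> blows up at \<open>t = 1\<close> but is the derivative of \<open>arcsin\<close>; this also
    covers correlations of modulus one.\<close>
  have "norm (\<Psi> 1 - \<Psi> 0) \<le> A * arcsin 1 - A * arcsin 0"
  proof (rule differentiable_bound_general)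
    show "continuous_on {0..1} \<Psi>"
      using \<Psi>' by (meson continuous_at_imp_continuous_on has_vector_derivative_continuous)
    show "continuous_on {0..1} (\<lambda>t. A * arcsin t)"
      by (intro continuous_intros) auto
    show "((\<lambda>t. A * arcsin t) has_vector_derivative A * (1 / sqrt (1 - t\<^sup>2))) (at t)" if "0 < t" "t < 1" for t
      unfolding has_real_derivative_iff_has_vector_derivative[symmetric]
      using that by (auto intro!: derivative_eq_intros simp: inverse_eq_divide)
    show "(\<Psi> has_vector_derivative (\<Sum>i\<in>I. \<Sum>j\<in>I. of_real ((K i j - L i j) / 2) *
        of_real (\<integral>x. (\<Prod>k\<in>I. if k = i \<or> k = j then cos_poly_deriv l P (?Y t k x)
                 else cos_poly l P (?Y t k x)) \<partial>?N))) (at t)" if "0 < t" "t < 1" for t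
      using \<Psi>'[of t] that by simp
    show "norm (\<Sum>i\<in>I. \<Sum>j\<in>I. complex_of_real ((K i j - L i j) / 2) *
        of_real (\<integral>x. (\<Prod>k\<in>I. if k = i \<or> k = j then cos_poly_deriv l P (?Y t k x)
                 else cos_poly l P (?Y t k x)) \<partial>?N)) \<le> A * (1 / sqrt (1 - t\<^sup>2))" if t: "0 < t" "t < 1" for t
    proof -
      have "norm (\<Sum>i\<in>I. \<Sum>j\<in>I. complex_of_real ((K i j - L i j) / 2) *
        of_real (\<integral>x. (\<Prod>k\<in>I. if k = i \<or> k = j then cos_poly_deriv l P (?Y t k x)
                 else cos_poly l P (?Y t k x)) \<partial>?N)) \<le>
        (\<Sum>i\<in>I. \<Sum>j\<in>I. if j = i then 0 else B ^ card I / (4 * pi) * (\<bar>K i j\<bar> * V i j) * (1 / sqrt (1 - t\<^sup>2)))"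
        unfolding of_real_mult[symmetric] of_real_sum[symmetric] norm_of_real
        by (intro sum_abs[THEN order_trans] sum_mono summand t)
      also have "\<dots> = (\<Sum>i\<in>I. \<Sum>j\<in>I - {i}. B ^ card I / (4 * pi) * (\<bar>K i j\<bar> * V i j) * (1 / sqrt (1 - t\<^sup>2)))"
        using I by (intro sum.cong refl sum.mono_neutral_cong_right) auto
      also have "\<dots> = A * (1 / sqrt (1 - t\<^sup>2))"
        by (simp only: A_def sum_distrib_left sum_distrib_right)
      finally show ?thesis .
    qed
  qed simp
  moreover have "\<Psi> 1 = of_real (\<integral>x. (\<Prod>k\<in>I. cos_poly l P (X k x)) \<partial>M)"
  proof -
    have "gaussian_family ?N I (?Y 1) K" using GY[of 1] by simp
    from gaussian_family_expectation_cos_poly_unique[OF this G I] show ?thesis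
      by (subst \<Psi>) simp_all
  qed
  \<comment> \<open>At t = 0 the family has covariance \<open>L\<close>, so by uniqueness the
    expectation is that of the product measure and factorises.\<close>
  moreover have "\<Psi> 0 = of_real ((\<integral>x. cos_poly l P x \<partial>std_normal_distribution) ^ card I)"
  proof -
    have "gaussian_family ?N I (?Y 0) L" using GY[of 0] by simp
    from gaussian_family_expectation_cos_poly_unique[OF this GZ I]
    have "\<Psi> 0 = of_real (\<integral>y. (\<Prod>k\<in>I. cos_poly l P (y k)) \<partial>?Z)"
      by (subst \<Psi>) simp_all
    also have "(\<integral>y. (\<Prod>k\<in>I. cos_poly l P (y k)) \<partial>?Z) = (\<integral>x. cos_poly l P x \<partial>std_normal_distribution) ^ card I"
      using B(2) by (subst Z.product_integral_prod[OF I])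
        (auto intro!: std_normal.integrable_const_bound[where B = B])
    finally show ?thesis .
  qed
  ultimately have "\<bar>(\<integral>x. (\<Prod>k\<in>I. cos_poly l P (X k x)) \<partial>M) - (\<integral>x. cos_poly l P x \<partial>std_normal_distribution) ^ card I\<bar>
     \<le> A * (pi / 2)"
    by (simp add: of_real_diff[symmetric] of_real_power[symmetric] del: of_real_diff of_real_power)
  also have "\<dots> = B ^ card I / 8 * (\<Sum>i\<in>I. \<Sum>j\<in>I - {i}. \<bar>K i j\<bar> * V i j)"
    by (simp add: A_def)
  finally show ?thesis unfolding V_def .
qed

subsection \<open>Approximation of indicator functions\<close>

text \<open>A tent supported on \<open>{u..u + d}\<close> with peak \<open>2 / d\<close> in the
  middle, hence of mass one. The second difference of \<open>max 0\<close> avoids case distinctions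
  and makes continuity immediate.\<close>

definition hat :: "real \<Rightarrow> real \<Rightarrow> real \<Rightarrow> real" where
  "hat u d x = 4 / d\<^sup>2 * (max 0 (x - u) - 2 * max 0 (x - u - d / 2) + max 0 (x - u - d))"

text \<open>One minus the antiderivative of \<open>hat\<close>: each \<open>max 0\<close> term is
  replaced by half its square. The descent from 1 to 0 is continuously differentiable, so its
  derivative can be approximated uniformly.\<close>

definition ramp :: "real \<Rightarrow> real \<Rightarrow> real \<Rightarrow> real" where
  "ramp u d x = 1 - 2 / d\<^sup>2 * ((max 0 (x - u))\<^sup>2 - 2 * (max 0 (x - u - d / 2))\<^sup>2 + (max 0 (x - u - d))\<^sup>2)"

lemma max_0_square_has_derivative: "((\<lambda>x. (max 0 x)\<^sup>2) has_real_derivative 2 * max 0 x) (at x)" for x :: real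
proof -
  consider "x < 0" | "x = 0" | "0 < x" by linarith
  then show ?thesis
  proof cases
    case 1
    have "((\<lambda>x::real. 0) has_real_derivative 2 * max 0 x) (at x)" using 1 by simp
    then show ?thesis
      by (rule has_field_derivative_transform_within_open[where S = "{..<0}"]) (use 1 in auto)
  next
    case 2
    have "(\<lambda>h. (max 0 h)\<^sup>2 / h) \<midarrow>0\<rightarrow> (0::real)"
    proof (rule Lim_null_comparison)
      show "\<forall>\<^sub>F h in at 0. norm ((max 0 h)\<^sup>2 / h) \<le> \<bar>h\<bar>"
        by (intro always_eventually allI) (auto simp: max_def power2_eq_square)
      show "(\<lambda>h::real. \<bar>h\<bar>) \<midarrow>0\<rightarrow> 0" by (rule tendsto_eq_intros refl | simp)+
    qed
    then show ?thesis using 2 by (simp add: DERIV_def)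
  next
    case 3
    have "((\<lambda>x. x\<^sup>2) has_real_derivative 2 * max 0 x) (at x)"
      using 3 by (auto intro!: derivative_eq_intros)
    then show ?thesis
      by (rule has_field_derivative_transform_within_open[where S = "{0<..}"]) (use 3 in auto)
  qed
qed

lemma ramp_has_derivative: "(ramp u d has_real_derivative - hat u d x) (at x)"
proof -
  have *: "((\<lambda>x. (max 0 (x - c))\<^sup>2) has_real_derivative 2 * max 0 (x - c)) (at x)" for c
  proof -
    have "((\<lambda>x. x - c) has_real_derivative 1) (at x)" by (auto intro!: derivative_eq_intros)
    from DERIV_chain2[OF max_0_square_has_derivative this] show ?thesis by simp
  qed
  have "((\<lambda>x. 1 - 2 / d\<^sup>2 * ((max 0 (x - u))\<^sup>2 - 2 * (max 0 (x - (u + d / 2)))\<^sup>2 + (max 0 (x - (u + d)))\<^sup>2))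
     has_real_derivative 0 - 2 / d\<^sup>2 * (2 * max 0 (x - u) - 2 * (2 * max 0 (x - (u + d / 2))) + 2 * max 0 (x - (u + d)))) (at x)"
    by (intro DERIV_diff DERIV_cmult DERIV_add DERIV_const *)
  then show ?thesis
    unfolding ramp_def[abs_def] hat_def by (simp add: algebra_simps)
qed

lemma continuous_on_hat [continuous_intros]: "continuous_on S f \<Longrightarrow> continuous_on S (\<lambda>x. hat u d (f x))"
  unfolding hat_def by (intro continuous_intros)

lemma continuous_on_ramp: "continuous_on S (ramp u d)"
  unfolding ramp_def[abs_def] by (intro continuous_intros)

lemma hat_measurable [measurable]: "hat u d \<in> borel_measurable borel"
  by (intro borel_measurable_continuous_onI continuous_on_hat continuous_on_id)

lemma ramp_measurable [measurable]: "ramp u d \<in> borel_measurable borel"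
  by (intro borel_measurable_continuous_onI continuous_on_ramp)

context
  fixes u d :: real
  assumes d: "0 < d"
begin

lemma hat_nonneg: "0 \<le> hat u d x"
  unfolding hat_def using d by (intro mult_nonneg_nonneg) (auto simp: max_def)

lemma hat_le: "hat u d x \<le> 2 / d"
proof -
  have "max 0 (x - u) - 2 * max 0 (x - u - d / 2) + max 0 (x - u - d) \<le> d / 2"
    using d by (auto simp: max_def)
  then have "hat u d x \<le> 4 / d\<^sup>2 * (d / 2)"
    unfolding hat_def by (intro mult_left_mono) auto
  then show ?thesis using d by (simp add: power2_eq_square)
qed

lemma hat_eq_0: "x \<le> u \<or> u + d \<le> x \<Longrightarrow> hat u d x = 0"
  unfolding hat_def using d by (auto simp: max_def)

lemma ramp_eq_1: "x \<le> u \<Longrightarrow> ramp u d x = 1"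
  unfolding ramp_def using d by (simp add: max_def)

lemma ramp_eq_0: "u + d \<le> x \<Longrightarrow> ramp u d x = 0"
proof -
  assume "u + d \<le> x"
  then have "max 0 (x - u) = x - u" "max 0 (x - u - d / 2) = x - u - d / 2" "max 0 (x - u - d) = x - u - d"
    using d by (auto simp: max_def)
  moreover have "(x - u)\<^sup>2 - 2 * (x - u - d / 2)\<^sup>2 + (x - u - d)\<^sup>2 = d\<^sup>2 / 2"
    by (simp add: power2_eq_square field_simps)
  ultimately show "ramp u d x = 0"
    unfolding ramp_def using d by simp
qed

lemma ramp_antimono: "x \<le> y \<Longrightarrow> ramp u d y \<le> ramp u d x"
  using ramp_has_derivative hat_nonneg
  by (intro DERIV_nonpos_imp_nonincreasing[of x y]) (auto intro!: exI)

lemma ramp_bounds: "0 \<le> ramp u d x" "ramp u d x \<le> 1"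
  using ramp_antimono[of x "max x (u + d)"] ramp_eq_0[of "max x (u + d)"]
    ramp_antimono[of "min x u" x] ramp_eq_1[of "min x u"] by auto

lemma integral_hat:
  shows "integrable lborel (hat u d)" and "(\<integral>x. hat u d x \<partial>lborel) = 1"
proof -
  have "((\<lambda>x. - ramp u d x) has_real_derivative hat u d x) (at x)" for x
    using DERIV_minus[OF ramp_has_derivative] by simp
  moreover have "isCont (hat u d) x" for x
    using continuous_on_hat[of UNIV "\<lambda>x. x"] by (simp add: continuous_on_eq_continuous_at)
  ultimately have "has_bochner_integral lborel (\<lambda>x. hat u d x * indicator {u..u + d} x) (- ramp u d (u + d) - (- ramp u d u))"
    using d by (intro has_bochner_integral_FTC_Icc_real) auto
  moreover have "hat u d x * indicator {u..u + d} x = hat u d x" for x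
    using hat_eq_0[of x] by (cases "x \<le> u \<or> u + d \<le> x") (auto simp: indicator_def)
  ultimately have "has_bochner_integral lborel (hat u d) 1"
    by (simp add: ramp_eq_0 ramp_eq_1)
  then show "integrable lborel (hat u d)" "(\<integral>x. hat u d x \<partial>lborel) = 1"
    by (auto simp: has_bochner_integral_iff)
qed

end

lemma poly_antiderivative: "\<exists>P. pderiv P = (Q :: real poly)"
proof
  have sum: "pderiv (\<Sum>i\<in>A. f i) = (\<Sum>i\<in>A. pderiv (f i))" for A :: "nat set" and f :: "nat \<Rightarrow> real poly"
    by (induction A rule: infinite_finite_induct) (simp_all add: pderiv_add)
  have "pderiv (\<Sum>i\<le>degree Q. monom (coeff Q i / real (Suc i)) (Suc i)) = (\<Sum>i\<le>degree Q. monom (coeff Q i) i)"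
    by (simp add: sum pderiv_monom del: of_nat_Suc)
  also have "\<dots> = Q" by (rule poly_as_sum_of_monoms)
  finally show "pderiv (\<Sum>i\<le>degree Q. monom (coeff Q i / real (Suc i)) (Suc i)) = Q" .
qed

text \<open>The function \<open>x \<mapsto> m * arccos (cos (x / m))\<close> is the even periodic continuation of \<open>x\<close> from
  \<open>[0, pi * m]\<close>. The approximation is first done for the derivative, in the variable \<open>cos (x / m)\<close>; the factor
  \<open>sin (x / m)\<close> can be divided out because \<open>hat u d\<close> vanishes near the ends of this interval.\<close>

lemma ramp_cos_poly_approx:
  assumes u: "0 < u" and d: "0 < d" and m: "0 < m" "u + d < pi * m" and e: "0 < e"
  obtains P where
    "\<And>x. \<bar>cos_poly (1 / m) P x - ramp u d (m * arccos (cos (x / m)))\<bar> \<le> e"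
    "\<And>x. \<bar>\<bar>cos_poly_deriv (1 / m) P x\<bar> - hat u d (m * arccos (cos (x / m)))\<bar> \<le> e"
proof -
  \<comment> \<open>The support of \<open>hat u d\<close> lies strictly inside the interval from 0
    to \<open>pi * m\<close>, so the sine has a positive minimum \<open>c\<close> on it.\<close>
  obtain x0 where x0: "x0 \<in> {u..u + d}" "\<And>x. x \<in> {u..u + d} \<Longrightarrow> sin (x0 / m) \<le> sin (x / m)"
    using continuous_attains_inf[of "{u..u + d}" "\<lambda>x. sin (x / m)"] u d m
    by (force intro!: continuous_intros)
  define c where "c = sin (x0 / m)"
  have c: "0 < c"
    unfolding c_def using x0(1) u d m by (intro sin_gt_zero) (auto simp: field_simps)
  \<comment> \<open>This is \<open>hat\<close> divided by \<open>sin (x / m) / m\<close> in the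
    variable y = cos(x / m). Cutting the denominator off at \<open>c\<close> gives continuity on all
    of \<open>{-1..1}\<close> and changes nothing on the support of \<open>hat\<close>.\<close>
  define f where "f y = m * hat u d (m * arccos y) / max (sqrt (1 - y\<^sup>2)) c" for y
  \<comment> \<open>The derivative error is \<open>\<epsilon> / m\<close>; integrated over a length
    of at most \<open>pi * m\<close> it becomes a value error of \<open>\<epsilon> * pi\<close>.
    Both must be at most \<open>e\<close>.\<close>
  define \<epsilon> where "\<epsilon> = min (e / pi) (e * m)"
  have \<epsilon>: "0 < \<epsilon>" "\<epsilon> * pi \<le> e" "\<epsilon> / m \<le> e"
    using e m by (auto simp: \<epsilon>_def min_def field_simps)
  have "continuous_on {-1..1} f"
    unfolding f_def using c by (intro continuous_intros) (auto simp: max_def)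
  then obtain Q where Q: "\<And>y. y \<in> {-1..1} \<Longrightarrow> \<bar>poly Q y - f y\<bar> < \<epsilon>"
    using Weierstrass_poly_uniform \<epsilon>(1) by metis
  obtain P0 where P0: "pderiv P0 = Q" using poly_antiderivative by blast
  \<comment> \<open>The constant of integration makes \<open>p\<close> vanish at
    \<open>pi * m\<close>, where the cosine is -1 and \<open>ramp\<close> vanishes too; the error is
    then integrated from that end.\<close>
  define P where "P = P0 - [:poly P0 (-1):]"
  have P: "pderiv P = Q" "poly P (-1) = 0"
    by (simp_all add: P_def pderiv_diff P0 pderiv_pCons)
  define p where "p = cos_poly (1 / m) P"
  define p' where "p' = cos_poly_deriv (1 / m) P"
  have deriv: "\<bar>p' y + hat u d y\<bar> \<le> \<epsilon> / m" if y: "0 \<le> y" "y \<le> pi * m" for y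
  proof -
    have s: "0 \<le> sin (y / m)" using y m by (intro sin_ge_zero) (auto simp: field_simps)
    have "sqrt (1 - (cos (y / m))\<^sup>2) = sin (y / m)"
      using s by (simp add: sin_squared_eq[symmetric])
    moreover have "m * arccos (cos (y / m)) = y"
      using y m by (simp add: arccos_cos field_simps)
    ultimately have f: "f (cos (y / m)) = m * hat u d y / max (sin (y / m)) c"
      by (simp add: f_def)
    have "sin (y / m) * f (cos (y / m)) / m = hat u d y"
    proof (cases "y \<in> {u..u + d}")
      case True
      then have "max (sin (y / m)) c = sin (y / m)" using x0(2)[of y] by (simp add: c_def)
      moreover have "0 < sin (y / m)" using x0(2)[OF True] c by (simp add: c_def)
      ultimately show ?thesis using m by (simp add: f)
    next
      case False
      then show ?thesis using hat_eq_0[OF d, of y u] by (auto simp: f)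
    qed
    then have "p' y + hat u d y = - (sin (y / m) / m * (poly Q (cos (y / m)) - f (cos (y / m))))"
      by (simp add: p'_def cos_poly_deriv_def P algebra_simps)
    then have "\<bar>p' y + hat u d y\<bar> = sin (y / m) / m * \<bar>poly Q (cos (y / m)) - f (cos (y / m))\<bar>"
      using s m by (simp add: abs_mult)
    also have "\<dots> \<le> 1 / m * \<epsilon>"
      using s m Q[of "cos (y / m)"] by (intro mult_mono divide_right_mono) (auto intro: less_imp_le)
    finally show ?thesis by simp
  qed
  have val: "\<bar>p y - ramp u d y\<bar> \<le> e" if y: "0 \<le> y" "y \<le> pi * m" for y
  proof -
    have "norm ((p (pi * m) - ramp u d (pi * m)) - (p y - ramp u d y)) \<le> \<epsilon> / m * norm (pi * m - y)"
    proof (rule field_differentiable_bound[where S = "{0..pi * m}" and f = "\<lambda>y. p y - ramp u d y"])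
      show "((\<lambda>y. p y - ramp u d y) has_field_derivative p' z + hat u d z) (at z within {0..pi * m})" for z
        using DERIV_diff[OF cos_poly_has_derivative ramp_has_derivative] unfolding p_def p'_def
        by (simp add: has_field_derivative_at_within)
    qed (use y m deriv in auto)
    moreover have "p (pi * m) = 0"
      using m P(2) by (simp add: p_def cos_poly_def)
    moreover have "ramp u d (pi * m) = 0"
      using m d by (intro ramp_eq_0) auto
    ultimately have "\<bar>p y - ramp u d y\<bar> \<le> \<epsilon> / m * (pi * m - y)"
      using y by simp
    also have "\<dots> \<le> \<epsilon> / m * (pi * m)"
      using y m \<epsilon> by (intro mult_left_mono) auto
    finally show ?thesis using m \<epsilon> by simp
  qed
  show ?thesis
  proof (rule that)
    fix x
    define y where "y = m * arccos (cos (x / m))"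
    have y: "0 \<le> y" "y \<le> pi * m"
      using m arccos_lbound[of "cos (x / m)"] arccos_ubound[of "cos (x / m)"] by (auto simp: y_def)
    have cy: "cos (y / m) = cos (x / m)" using m by (simp add: y_def)
    \<comment> \<open>Folding x into \<open>y\<close> may reverse the sign of the sine, so the
      derivative is controlled in absolute value only.\<close>
    have sy: "\<bar>sin (y / m)\<bar> = \<bar>sin (x / m)\<bar>"
      using cy sin_squared_eq[of "y / m"] sin_squared_eq[of "x / m"] by (metis real_sqrt_abs)
    have "p x = p y" using cy by (simp add: p_def cos_poly_def)
    then show "\<bar>cos_poly (1 / m) P x - ramp u d (m * arccos (cos (x / m)))\<bar> \<le> e"
      using val[OF y] by (simp add: p_def y_def[symmetric])
    have "\<bar>p' x\<bar> = \<bar>p' y\<bar>" using cy sy by (simp add: p'_def cos_poly_deriv_def abs_mult)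
    then show "\<bar>\<bar>cos_poly_deriv (1 / m) P x\<bar> - hat u d (m * arccos (cos (x / m)))\<bar> \<le> e"
      using deriv[OF y] \<epsilon>(3) hat_nonneg[OF d, of u y] by (simp add: p'_def y_def[symmetric])
  qed
qed

subsection \<open>The comparison inequality for the maximum\<close>

lemma integrable_gaussian_weight:
  assumes "0 < c"
  shows "integrable lborel (\<lambda>x::real. exp (- x\<^sup>2 / c))"
proof -
  have "(\<lambda>x. exp (- x\<^sup>2 / c)) = (\<lambda>x. sqrt (pi * c) * normal_density 0 (sqrt (c / 2)) x)"
    using assms by (simp add: normal_density_def fun_eq_iff)
  then show ?thesis using assms by simp
qed

text \<open>The function consists of two tents of mass one, mirror images of each other, and on both
  the weight is at most its value at distance \<open>u\<close> from the origin.\<close>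

lemma integral_hat_abs_weight_le:
  assumes u: "0 < u" and d: "0 < d" and c: "0 < c"
  shows "0 \<le> (\<integral>x. hat u d \<bar>x\<bar> * exp (- x\<^sup>2 / c) \<partial>lborel)"
    and "(\<integral>x. hat u d \<bar>x\<bar> * exp (- x\<^sup>2 / c) \<partial>lborel) \<le> 2 * exp (- u\<^sup>2 / c)"
proof -
  have hat_abs: "hat u d \<bar>x\<bar> = hat u d x + hat u d (- x)" for x
    using hat_eq_0[OF d, of "- \<bar>x\<bar>" u] u by (cases "0 \<le> x") auto
  have int_neg: "integrable lborel (\<lambda>x. hat u d (- x))"
    using lborel_integrable_real_affine[OF integral_hat(1)[OF d, of u], of "-1" 0] by simp
  then have int: "integrable lborel (\<lambda>x. hat u d \<bar>x\<bar>)"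
    unfolding hat_abs using integral_hat[OF d] by (intro Bochner_Integration.integrable_add) auto
  have "(\<integral>x. hat u d (- x) \<partial>lborel) = 1"
    using lborel_integral_real_affine[of "-1" "hat u d" 0] integral_hat[OF d] by simp
  then have one: "(\<integral>x. hat u d \<bar>x\<bar> \<partial>lborel) = 2"
    unfolding hat_abs using integral_hat[OF d] int_neg by (subst Bochner_Integration.integral_add) auto
  show "0 \<le> (\<integral>x. hat u d \<bar>x\<bar> * exp (- x\<^sup>2 / c) \<partial>lborel)"
    using hat_nonneg[OF d] by (intro integral_nonneg_AE) auto
  have "(\<integral>x. hat u d \<bar>x\<bar> * exp (- x\<^sup>2 / c) \<partial>lborel) \<le> (\<integral>x. hat u d \<bar>x\<bar> * exp (- u\<^sup>2 / c) \<partial>lborel)"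
  proof (rule integral_mono')
    show "hat u d \<bar>x\<bar> * exp (- x\<^sup>2 / c) \<le> hat u d \<bar>x\<bar> * exp (- u\<^sup>2 / c)" for x
    proof (cases "\<bar>x\<bar> \<le> u")
      case True
      then show ?thesis using hat_eq_0[OF d, of "\<bar>x\<bar>" u] by simp
    next
      case False
      then have "u\<^sup>2 \<le> x\<^sup>2" using u by (simp add: abs_le_square_iff[symmetric])
      then show ?thesis using hat_nonneg[OF d] c by (intro mult_left_mono) (auto simp: divide_right_mono)
    qed
  qed (use int hat_nonneg[OF d] in auto)
  also have "\<dots> = 2 * exp (- u\<^sup>2 / c)"
    using one by simp
  finally show "(\<integral>x. hat u d \<bar>x\<bar> * exp (- x\<^sup>2 / c) \<partial>lborel) \<le> 2 * exp (- u\<^sup>2 / c)" .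
qed

lemma eventually_arccos_cos_scaled:
  fixes m :: "nat \<Rightarrow> real"
  assumes "filterlim m at_top sequentially"
  shows "\<forall>\<^sub>F n in sequentially. m n * arccos (cos (x / m n)) = \<bar>x\<bar>"
proof -
  have "\<forall>\<^sub>F n in sequentially. \<bar>x\<bar> + 1 \<le> m n"
    using assms by (simp add: filterlim_at_top)
  then show ?thesis
  proof eventually_elim
    case (elim n)
    have pos: "0 < m n" using elim abs_ge_zero[of x] by linarith
    then have "\<bar>x / m n\<bar> \<le> 1" using elim by (simp add: abs_divide)
    then have "\<bar>x / m n\<bar> \<le> pi" using pi_gt3 by linarith
    then have "arccos (cos (x / m n)) = \<bar>x / m n\<bar>" by (rule arccos_cos_eq_abs)
    then show ?case using pos by (simp add: abs_divide)
  qed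
qed

text \<open>As the half-period \<open>pi * m n\<close> tends to infinity, the periodic copies of the
  ramp leave every bounded set. This gives pointwise limits on the line, and the uniform bounds
  serve for dominated convergence.\<close>

lemma ramp_cos_poly_sequence:
  assumes u: "0 < u" and d: "0 < d"
  obtains m :: "nat \<Rightarrow> real" and P where
    "\<And>n x. \<bar>cos_poly (1 / m n) (P n) x\<bar> \<le> 1 + 1 / (real n + 1)"
    "\<And>n x. \<bar>cos_poly_deriv (1 / m n) (P n) x\<bar> \<le> 2 / d + 1"
    "\<And>x. (\<lambda>n. cos_poly (1 / m n) (P n) x) \<longlonglongrightarrow> ramp u d \<bar>x\<bar>"
    "\<And>x. (\<lambda>n. \<bar>cos_poly_deriv (1 / m n) (P n) x\<bar>) \<longlonglongrightarrow> hat u d \<bar>x\<bar>"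
proof -
  \<comment> \<open>The summand \<open>u + d\<close> keeps the support of \<open>hat\<close> within
    the first half-period for every n, because pi > 1.\<close>
  define m where "m n = u + d + real n" for n
  define y where "y n x = m n * arccos (cos (x / m n))" for n x
  define e where "e n = 1 / (real n + 1)" for n
  have e: "0 < e n" "e n \<le> 1" for n by (auto simp: e_def)
  have e0: "e \<longlonglongrightarrow> 0"
    unfolding e_def using LIMSEQ_inverse_real_of_nat by (simp add: inverse_eq_divide add.commute)
  have m: "0 < m n" "u + d < pi * m n" for n
  proof -
    show "0 < m n" using u d by (simp add: m_def)
    then have "m n < pi * m n" using pi_gt3 by simp
    then show "u + d < pi * m n" by (simp add: m_def)
  qed
  have "\<exists>P. \<forall>x. \<bar>cos_poly (1 / m n) P x - ramp u d (y n x)\<bar> \<le> e n \<and>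
      \<bar>\<bar>cos_poly_deriv (1 / m n) P x\<bar> - hat u d (y n x)\<bar> \<le> e n" for n
    unfolding y_def by (rule ramp_cos_poly_approx[OF u d m e(1)]) blast
  then obtain P where P: "\<And>n x. \<bar>cos_poly (1 / m n) (P n) x - ramp u d (y n x)\<bar> \<le> e n"
    and P': "\<And>n x. \<bar>\<bar>cos_poly_deriv (1 / m n) (P n) x\<bar> - hat u d (y n x)\<bar> \<le> e n"
    by metis
  have mlim: "filterlim m at_top sequentially"
    unfolding m_def by (intro filterlim_tendsto_add_at_top[OF tendsto_const] filterlim_real_sequentially)
  have lim: "f \<longlonglongrightarrow> g \<bar>x\<bar>" if "\<And>n. \<bar>f n - g (y n x)\<bar> \<le> e n" for f and g :: "real \<Rightarrow> real" and x
  proof (rule LIM_zero_cancel, rule Lim_null_comparison[OF _ e0])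
    show "\<forall>\<^sub>F n in sequentially. norm (f n - g \<bar>x\<bar>) \<le> e n"
      using eventually_arccos_cos_scaled[OF mlim, of x]
    proof eventually_elim
      case (elim n)
      with that[of n] show ?case by (simp add: y_def)
    qed
  qed
  show ?thesis
  proof (rule that)
    show "\<bar>cos_poly (1 / m n) (P n) x\<bar> \<le> 1 + 1 / (real n + 1)" for n x
      using P[of n x] ramp_bounds[OF d, of u "y n x"] unfolding e_def by linarith
    show "\<bar>cos_poly_deriv (1 / m n) (P n) x\<bar> \<le> 2 / d + 1" for n x
      using P'[of n x] hat_le[OF d, of u "y n x"] e(2)[of n] by linarith
    show "(\<lambda>n. cos_poly (1 / m n) (P n) x) \<longlonglongrightarrow> ramp u d \<bar>x\<bar>" for x
      by (rule lim) (rule P)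
    show "(\<lambda>n. \<bar>cos_poly_deriv (1 / m n) (P n) x\<bar>) \<longlonglongrightarrow> hat u d \<bar>x\<bar>" for x
      by (rule lim) (rule P')
  qed
qed

lemma (in prob_space) tendsto_expectation_prod:
  fixes f :: "nat \<Rightarrow> real \<Rightarrow> real"
  assumes X: "\<And>i. i \<in> I \<Longrightarrow> X i \<in> borel_measurable M"
    and f: "\<And>n. f n \<in> borel_measurable borel" "g \<in> borel_measurable borel"
    and bd: "\<And>n x. \<bar>f n x\<bar> \<le> B" and lim: "\<And>x. (\<lambda>n. f n x) \<longlonglongrightarrow> g x"
  shows "(\<lambda>n. \<integral>x. (\<Prod>i\<in>I. f n (X i x)) \<partial>M) \<longlonglongrightarrow> (\<integral>x. (\<Prod>i\<in>I. g (X i x)) \<partial>M)"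
proof (rule integral_dominated_convergence[where w = "\<lambda>_. B ^ card I"])
  show "AE x in M. norm (\<Prod>i\<in>I. f n (X i x)) \<le> B ^ card I" for n
  proof (rule AE_I2)
    fix x
    have "(\<Prod>i\<in>I. \<bar>f n (X i x)\<bar>) \<le> (\<Prod>i\<in>I. B)"
      by (intro prod_mono) (simp add: bd)
    then show "norm (\<Prod>i\<in>I. f n (X i x)) \<le> B ^ card I"
      by (simp add: abs_prod)
  qed
  show "AE x in M. (\<lambda>n. \<Prod>i\<in>I. f n (X i x)) \<longlonglongrightarrow> (\<Prod>i\<in>I. g (X i x))"
    by (intro AE_I2 tendsto_prod lim)
  show "(\<lambda>x. \<Prod>i\<in>I. g (X i x)) \<in> borel_measurable M" "(\<lambda>x. \<Prod>i\<in>I. f n (X i x)) \<in> borel_measurable M" for n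
    by (intro borel_measurable_prod measurable_compose[OF X] f; assumption)+
qed simp


text \<open>In the limit the sup bound becomes 1 and each weighted integral is at most twice the
  weight at \<open>u\<close>; its square contributes 4, and 4/8 is the factor 1/2.\<close>

lemma gaussian_comparison_ramp:
  fixes I :: "'i set"
  assumes G: "gaussian_family M I X K" and I: "finite I"
    and K1: "\<And>i. i \<in> I \<Longrightarrow> K i i = 1" and Ks: "\<And>i j. i \<in> I \<Longrightarrow> j \<in> I \<Longrightarrow> K i j = K j i"
    and Kle: "\<And>i j. i \<in> I \<Longrightarrow> j \<in> I \<Longrightarrow> \<bar>K i j\<bar> \<le> 1"
    and u: "0 < u" and d: "0 < d"
  shows "\<bar>(\<integral>x. (\<Prod>k\<in>I. ramp u d \<bar>X k x\<bar>) \<partial>M) - (\<integral>x. ramp u d \<bar>x\<bar> \<partial>std_normal_distribution) ^ card I\<bar>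
    \<le> (\<Sum>i\<in>I. \<Sum>j\<in>I - {i}. \<bar>K i j\<bar> * exp (- u\<^sup>2 / (1 + \<bar>K i j\<bar>))) / 2"
proof -
  interpret prob_space M using G by (simp add: gaussian_family_def)
  have X: "X i \<in> borel_measurable M" if "i \<in> I" for i
    using G that by (simp add: gaussian_family_def)
  obtain m P where
    p: "\<And>n x. \<bar>cos_poly (1 / m n) (P n) x\<bar> \<le> 1 + 1 / (real n + 1)"
    and p': "\<And>n x. \<bar>cos_poly_deriv (1 / m n) (P n) x\<bar> \<le> 2 / d + 1"
    and lim: "\<And>x. (\<lambda>n. cos_poly (1 / m n) (P n) x) \<longlonglongrightarrow> ramp u d \<bar>x\<bar>"
    and lim': "\<And>x. (\<lambda>n. \<bar>cos_poly_deriv (1 / m n) (P n) x\<bar>) \<longlonglongrightarrow> hat u d \<bar>x\<bar>"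
    by (rule ramp_cos_poly_sequence[OF u d]) (rule that)
  have p2: "\<bar>cos_poly (1 / m n) (P n) x\<bar> \<le> 2" for n x
  proof -
    have "1 / (real n + 1) \<le> 1" by simp
    with p[of n x] show ?thesis by linarith
  qed
  let ?W = "\<lambda>n i j. \<integral>x. \<bar>cos_poly_deriv (1 / m n) (P n) x\<bar> * exp (- x\<^sup>2 / (2 * (1 + \<bar>K i j\<bar>))) \<partial>lborel"
  let ?H = "\<lambda>i j. \<integral>x. hat u d \<bar>x\<bar> * exp (- x\<^sup>2 / (2 * (1 + \<bar>K i j\<bar>))) \<partial>lborel"
  have W: "(\<lambda>n. ?W n i j) \<longlonglongrightarrow> ?H i j" for i j
  proof (rule integral_dominated_convergence[where w = "\<lambda>x. (2 / d + 1) * exp (- x\<^sup>2 / (2 * (1 + \<bar>K i j\<bar>)))"])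
    show "integrable lborel (\<lambda>x::real. (2 / d + 1) * exp (- x\<^sup>2 / (2 * (1 + \<bar>K i j\<bar>))))"
      by (intro integrable_mult_right integrable_gaussian_weight) (simp add: add_pos_nonneg)
    show "AE x in lborel. norm (\<bar>cos_poly_deriv (1 / m n) (P n) x\<bar> * exp (- x\<^sup>2 / (2 * (1 + \<bar>K i j\<bar>))))
        \<le> (2 / d + 1) * exp (- x\<^sup>2 / (2 * (1 + \<bar>K i j\<bar>)))" for n
      using p' by (intro AE_I2) (simp add: abs_mult)
    show "AE x in lborel. (\<lambda>n. \<bar>cos_poly_deriv (1 / m n) (P n) x\<bar> * exp (- x\<^sup>2 / (2 * (1 + \<bar>K i j\<bar>))))
        \<longlonglongrightarrow> hat u d \<bar>x\<bar> * exp (- x\<^sup>2 / (2 * (1 + \<bar>K i j\<bar>)))"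
      by (intro AE_I2 tendsto_mult lim' tendsto_const)
  qed measurable
  have B: "(\<lambda>n. 1 + 1 / (real n + 1)) \<longlonglongrightarrow> 1 + 0"
    by (intro tendsto_add tendsto_const) (use LIMSEQ_inverse_real_of_nat in \<open>simp add: inverse_eq_divide add.commute\<close>)
  have E: "(\<lambda>n. \<integral>x. (\<Prod>k\<in>I. cos_poly (1 / m n) (P n) (X k x)) \<partial>M) \<longlonglongrightarrow> (\<integral>x. (\<Prod>k\<in>I. ramp u d \<bar>X k x\<bar>) \<partial>M)"
    by (rule tendsto_expectation_prod[OF X _ _ p2 lim]) measurable
  \<comment> \<open>A one-element index set specialises the convergence of products to a single
    integral.\<close>
  have Z: "(\<lambda>n. \<integral>x. cos_poly (1 / m n) (P n) x \<partial>std_normal_distribution) \<longlonglongrightarrow> (\<integral>x. ramp u d \<bar>x\<bar> \<partial>std_normal_distribution)"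
    using std_normal.tendsto_expectation_prod[of "{()}" "\<lambda>_ x. x", OF _ _ _ p2 lim] by simp
  have "\<bar>(\<integral>x. (\<Prod>k\<in>I. ramp u d \<bar>X k x\<bar>) \<partial>M) - (\<integral>x. ramp u d \<bar>x\<bar> \<partial>std_normal_distribution) ^ card I\<bar>
      \<le> (1 + 0) ^ card I / 8 * (\<Sum>i\<in>I. \<Sum>j\<in>I - {i}. \<bar>K i j\<bar> * (?H i j)\<^sup>2)"
  proof (rule LIMSEQ_le)
    show "(\<lambda>n. \<bar>(\<integral>x. (\<Prod>k\<in>I. cos_poly (1 / m n) (P n) (X k x)) \<partial>M) -
        (\<integral>x. cos_poly (1 / m n) (P n) x \<partial>std_normal_distribution) ^ card I\<bar>)
      \<longlonglongrightarrow> \<bar>(\<integral>x. (\<Prod>k\<in>I. ramp u d \<bar>X k x\<bar>) \<partial>M) - (\<integral>x. ramp u d \<bar>x\<bar> \<partial>std_normal_distribution) ^ card I\<bar>"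
      by (intro tendsto_intros E Z)
    show "(\<lambda>n. (1 + 1 / (real n + 1)) ^ card I / 8 * (\<Sum>i\<in>I. \<Sum>j\<in>I - {i}. \<bar>K i j\<bar> * (?W n i j)\<^sup>2))
      \<longlonglongrightarrow> (1 + 0) ^ card I / 8 * (\<Sum>i\<in>I. \<Sum>j\<in>I - {i}. \<bar>K i j\<bar> * (?H i j)\<^sup>2)"
      by (intro tendsto_mult tendsto_divide tendsto_power tendsto_sum tendsto_const B W) simp
    show "\<exists>N. \<forall>n\<ge>N. \<bar>(\<integral>x. (\<Prod>k\<in>I. cos_poly (1 / m n) (P n) (X k x)) \<partial>M) -
        (\<integral>x. cos_poly (1 / m n) (P n) x \<partial>std_normal_distribution) ^ card I\<bar>
      \<le> (1 + 1 / (real n + 1)) ^ card I / 8 * (\<Sum>i\<in>I. \<Sum>j\<in>I - {i}. \<bar>K i j\<bar> * (?W n i j)\<^sup>2)"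
      by (intro exI allI impI gaussian_comparison_cos_poly[OF G I K1 Ks Kle _ p]) auto
  qed
  also have "\<dots> \<le> (1 + 0) ^ card I / 8 * (\<Sum>i\<in>I. \<Sum>j\<in>I - {i}. \<bar>K i j\<bar> * (4 * exp (- u\<^sup>2 / (1 + \<bar>K i j\<bar>))))"
  proof (intro mult_left_mono sum_mono)
    fix i j
    have c: "0 < 2 * (1 + \<bar>K i j\<bar>)" by (simp add: add_pos_nonneg)
    have "(?H i j)\<^sup>2 \<le> (2 * exp (- u\<^sup>2 / (2 * (1 + \<bar>K i j\<bar>))))\<^sup>2"
      by (intro power_mono integral_hat_abs_weight_le u d c)
    also have "\<dots> = 4 * exp (2 * (- u\<^sup>2 / (2 * (1 + \<bar>K i j\<bar>))))"
      unfolding power_mult_distrib exp_double by simp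
    also have "2 * (- u\<^sup>2 / (2 * (1 + \<bar>K i j\<bar>))) = - u\<^sup>2 / (1 + \<bar>K i j\<bar>)"
      using mult_divide_mult_cancel_left[of 2 "- u\<^sup>2" "1 + \<bar>K i j\<bar>"] by simp
    finally show "(?H i j)\<^sup>2 \<le> 4 * exp (- u\<^sup>2 / (1 + \<bar>K i j\<bar>))" .
  qed auto
  also have "\<dots> = (\<Sum>i\<in>I. \<Sum>j\<in>I - {i}. \<bar>K i j\<bar> * exp (- u\<^sup>2 / (1 + \<bar>K i j\<bar>))) / 2"
    by (simp add: sum_distrib_left sum_divide_distrib)
  finally show ?thesis .
qed

text \<open>The bound for \<open>ramp\<close> does not contain \<open>d\<close>, so it survives d ->
  0. The descent starts at \<open>u\<close> itself, hence the limit is the indicator of the closed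
  interval.\<close>

theorem gaussian_comparison_max:
  fixes I :: "'i set"
  assumes G: "gaussian_family M I X K" and I: "finite I"
    and K1: "\<And>i. i \<in> I \<Longrightarrow> K i i = 1" and Ks: "\<And>i j. i \<in> I \<Longrightarrow> j \<in> I \<Longrightarrow> K i j = K j i"
    and Kle: "\<And>i j. i \<in> I \<Longrightarrow> j \<in> I \<Longrightarrow> \<bar>K i j\<bar> \<le> 1"
    and u: "0 < u"
  shows "\<bar>\<P>(x in M. \<forall>i\<in>I. \<bar>X i x\<bar> \<le> u) - measure std_normal_distribution {-u..u} ^ card I\<bar>
    \<le> (\<Sum>i\<in>I. \<Sum>j\<in>I - {i}. \<bar>K i j\<bar> * exp (- u\<^sup>2 / (1 + \<bar>K i j\<bar>))) / 2"
proof -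
  interpret prob_space M using G by (simp add: gaussian_family_def)
  have X [measurable]: "X i \<in> borel_measurable M" if "i \<in> I" for i
    using G that by (simp add: gaussian_family_def)
  define f where "f n x = ramp u (1 / (real n + 1)) \<bar>x\<bar>" for n x
  have d: "0 < 1 / (real n + 1)" for n by simp
  have f_le: "\<bar>f n x\<bar> \<le> 1" for n x
    using ramp_bounds[OF d[of n], of u "\<bar>x\<bar>"] by (simp add: f_def)
  have f_meas: "f n \<in> borel_measurable borel" for n
    unfolding f_def by measurable
  have d0: "(\<lambda>n. 1 / (real n + 1)) \<longlonglongrightarrow> 0"
    using LIMSEQ_inverse_real_of_nat by (simp add: inverse_eq_divide add.commute)
  have f_lim: "(\<lambda>n. f n x) \<longlonglongrightarrow> indicator {-u..u} x" for x
  proof (cases "\<bar>x\<bar> \<le> u")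
    case True
    then have "f n x = indicator {-u..u} x" for n
      using ramp_eq_1[OF d[of n], of "\<bar>x\<bar>" u] by (auto simp: f_def indicator_def)
    then show ?thesis by simp
  next
    case False
    then have "\<forall>\<^sub>F n in sequentially. 1 / (real n + 1) < \<bar>x\<bar> - u"
      using order_tendstoD(2)[OF d0, of "\<bar>x\<bar> - u"] by simp
    then have "\<forall>\<^sub>F n in sequentially. f n x = indicator {-u..u} x"
    proof eventually_elim
      case (elim n)
      then show ?case
        using False ramp_eq_0[OF d[of n], of u "\<bar>x\<bar>"] by (auto simp: f_def indicator_def abs_le_iff)
    qed
    then show ?thesis by (rule tendsto_eventually)
  qed
  have "(\<integral>x. (\<Prod>i\<in>I. indicat_real {-u..u} (X i x)) \<partial>M) = (\<integral>x. indicator {x \<in> space M. \<forall>i\<in>I. \<bar>X i x\<bar> \<le> u} x \<partial>M)"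
  proof (intro Bochner_Integration.integral_cong refl)
    fix x assume "x \<in> space M"
    then show "(\<Prod>i\<in>I. indicat_real {-u..u} (X i x)) = (indicator {x \<in> space M. \<forall>i\<in>I. \<bar>X i x\<bar> \<le> u} x :: real)"
      using I by (cases "\<forall>i\<in>I. \<bar>X i x\<bar> \<le> u") (auto simp: indicator_def abs_le_iff minus_le_iff intro!: prod.neutral)
  qed
  also have "\<dots> = \<P>(x in M. \<forall>i\<in>I. \<bar>X i x\<bar> \<le> u)"
    using I by simp
  finally have PE: "(\<integral>x. (\<Prod>i\<in>I. indicat_real {-u..u} (X i x)) \<partial>M) = \<P>(x in M. \<forall>i\<in>I. \<bar>X i x\<bar> \<le> u)" .
  have E: "(\<lambda>n. \<integral>x. (\<Prod>i\<in>I. f n (X i x)) \<partial>M) \<longlonglongrightarrow> \<P>(x in M. \<forall>i\<in>I. \<bar>X i x\<bar> \<le> u)"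
    unfolding PE[symmetric] by (rule tendsto_expectation_prod[OF X f_meas _ f_le f_lim]) auto
  have Z: "(\<lambda>n. \<integral>x. f n x \<partial>std_normal_distribution) \<longlonglongrightarrow> measure std_normal_distribution {-u..u}"
    using std_normal.tendsto_expectation_prod[of "{()}" "\<lambda>_ x. x", OF _ f_meas _ f_le f_lim] by simp
  show ?thesis
  proof (rule LIMSEQ_le_const2)
    show "(\<lambda>n. \<bar>(\<integral>x. (\<Prod>i\<in>I. f n (X i x)) \<partial>M) - (\<integral>x. f n x \<partial>std_normal_distribution) ^ card I\<bar>) \<longlonglongrightarrow>
      \<bar>\<P>(x in M. \<forall>i\<in>I. \<bar>X i x\<bar> \<le> u) - measure std_normal_distribution {-u..u} ^ card I\<bar>"
      by (intro tendsto_intros E Z)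
    show "\<exists>N. \<forall>n\<ge>N. \<bar>(\<integral>x. (\<Prod>i\<in>I. f n (X i x)) \<partial>M) - (\<integral>x. f n x \<partial>std_normal_distribution) ^ card I\<bar>
      \<le> (\<Sum>i\<in>I. \<Sum>j\<in>I - {i}. \<bar>K i j\<bar> * exp (- u\<^sup>2 / (1 + \<bar>K i j\<bar>))) / 2"
      unfolding f_def by (intro exI allI impI gaussian_comparison_ramp[OF G I K1 Ks Kle u d])
  qed
qed

subsection \<open>Asymptotics of the threshold\<close>

text \<open>The second limit feeds the comparison error, the third the tail in the independent case.
  Both rest on \<open>(u x)\<^sup>2 = 2 * ln x - ln (ln x) + 2 * z - ln pi\<close> up to a vanishing
  term.\<close>

lemma gumbel_threshold_asymptotics:
  fixes z :: real
  defines "u \<equiv> \<lambda>x::real. 1 / sqrt (2 * ln x) * z + (sqrt (2 * ln x) - (ln (ln x) + ln pi) / (2 * sqrt (2 * ln x)))"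
  shows "filterlim u at_top at_top"
    and "((\<lambda>x. exp (- (u x)\<^sup>2) * x\<^sup>2 / ln x) \<longlongrightarrow> pi * exp (- 2 * z)) at_top"
    and "((\<lambda>x. x * (2 * std_normal_density (u x) / u x)) \<longlongrightarrow> exp (- z)) at_top"
proof -
  show u: "filterlim u at_top at_top"
    unfolding u_def by real_asymp
  \<comment> \<open>Writing u = s + w / s with s^2 = 2 ln x gives u^2 = s^2 + 2 w + w^2 / s^2. Only
    the last term is not exact, and it vanishes since w grows like ln ln x.\<close>
  have "((\<lambda>x::real. 2 * z - ln pi + (z - (ln (ln x) + ln pi) / 2)\<^sup>2 / (2 * ln x)) \<longlongrightarrow> 2 * z - ln pi + 0) at_top"
    by (intro tendsto_add tendsto_const) real_asymp
  moreover have "\<forall>\<^sub>F x in at_top. 2 * z - ln pi + (z - (ln (ln x) + ln pi) / 2)\<^sup>2 / (2 * ln x) =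
      (u x)\<^sup>2 - 2 * ln x + ln (ln x)"
    using eventually_gt_at_top[of 1]
  proof eventually_elim
    case (elim x)
    define s where "s = sqrt (2 * ln x)"
    have s: "0 < s" "s\<^sup>2 = 2 * ln x" using elim by (auto simp: s_def)
    have "u x = s + (z - (ln (ln x) + ln pi) / 2) / s"
      unfolding u_def s_def[symmetric] by (simp add: diff_divide_distrib)
    then have "(u x)\<^sup>2 = s\<^sup>2 + 2 * (z - (ln (ln x) + ln pi) / 2) + (z - (ln (ln x) + ln pi) / 2)\<^sup>2 / s\<^sup>2"
      using s(1) by (simp add: power2_sum power_divide)
    then show ?case by (simp add: s add_divide_distrib diff_divide_distrib)
  qed
  ultimately have sq: "((\<lambda>x. (u x)\<^sup>2 - 2 * ln x + ln (ln x)) \<longlongrightarrow> 2 * z - ln pi) at_top"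
    by (simp add: tendsto_cong)
  have e: "((\<lambda>x. exp (- ((u x)\<^sup>2 - 2 * ln x + ln (ln x)))) \<longlongrightarrow> exp (- (2 * z - ln pi))) at_top"
    by (intro tendsto_intros sq)
  have ev: "\<forall>\<^sub>F x in at_top. exp (- ((u x)\<^sup>2 - 2 * ln x + ln (ln x))) = exp (- (u x)\<^sup>2) * x\<^sup>2 / ln x"
    using eventually_gt_at_top[of 1]
  proof eventually_elim
    case (elim x)
    have "exp (- ((u x)\<^sup>2 - 2 * ln x + ln (ln x))) = exp (- (u x)\<^sup>2) * (exp (ln x))\<^sup>2 / exp (ln (ln x))"
      by (simp add: exp_diff exp_add exp_minus exp_double[symmetric] field_simps)
    then show ?case using elim by simp
  qed
  have "exp (- (2 * z - ln pi)) = pi * exp (- 2 * z)"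
    by (simp add: exp_diff exp_minus field_simps)
  with e ev show "((\<lambda>x. exp (- (u x)\<^sup>2) * x\<^sup>2 / ln x) \<longlongrightarrow> pi * exp (- 2 * z)) at_top"
    by (simp add: tendsto_cong)
  then have A: "((\<lambda>x. sqrt (exp (- (u x)\<^sup>2) * x\<^sup>2 / ln x)) \<longlongrightarrow> sqrt (pi * exp (- 2 * z))) at_top"
    by (rule tendsto_real_sqrt)
  have B: "((\<lambda>x. sqrt (2 * ln x) / u x) \<longlongrightarrow> 1) at_top"
    unfolding u_def by real_asymp
  \<comment> \<open>The expected tail is the square root of the previous quantity, with the
    denominator \<open>sqrt (2 * ln x)\<close> exchanged for the asymptotically equal
    \<open>u x\<close>.\<close>
  have "((\<lambda>x. sqrt (exp (- (u x)\<^sup>2) * x\<^sup>2 / ln x) * (sqrt (2 * ln x) / u x) / sqrt pi)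
      \<longlongrightarrow> sqrt (pi * exp (- 2 * z)) * 1 / sqrt pi) at_top"
    by (intro tendsto_intros A B) simp
  also have "sqrt (pi * exp (- 2 * z)) * 1 / sqrt pi = exp (- z)"
  proof -
    have "exp (- 2 * z) = (exp (- z))\<^sup>2" by (simp add: exp_double[symmetric])
    then show ?thesis by (simp add: real_sqrt_mult)
  qed
  finally have "((\<lambda>x. sqrt (exp (- (u x)\<^sup>2) * x\<^sup>2 / ln x) * (sqrt (2 * ln x) / u x) / sqrt pi) \<longlongrightarrow> exp (- z)) at_top" .
  moreover have "\<forall>\<^sub>F x in at_top. sqrt (exp (- (u x)\<^sup>2) * x\<^sup>2 / ln x) * (sqrt (2 * ln x) / u x) / sqrt pi =
      x * (2 * std_normal_density (u x) / u x)"
    using eventually_gt_at_top[of 1]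
  proof eventually_elim
    case (elim x)
    have "exp (- (u x)\<^sup>2) = (exp (- (u x)\<^sup>2 / 2))\<^sup>2" by (simp add: exp_double[symmetric])
    then have "sqrt (exp (- (u x)\<^sup>2) * x\<^sup>2 / ln x) = exp (- (u x)\<^sup>2 / 2) * x / sqrt (ln x)"
      using elim by (simp add: real_sqrt_mult real_sqrt_divide)
    then have "sqrt (exp (- (u x)\<^sup>2) * x\<^sup>2 / ln x) * (sqrt (2 * ln x) / u x) / sqrt pi
        = x * exp (- (u x)\<^sup>2 / 2) * sqrt 2 / (sqrt pi * u x)"
      using elim by (simp add: real_sqrt_mult mult_ac)
    also have "sqrt 2 = 2 / sqrt (2 :: real)" by (simp add: real_div_sqrt)
    finally show ?case by (simp add: std_normal_density_def real_sqrt_mult mult_ac)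
  qed
  ultimately show "((\<lambda>x. x * (2 * std_normal_density (u x) / u x)) \<longlongrightarrow> exp (- z)) at_top"
    by (simp add: tendsto_cong)
qed

text \<open>These are Mills ratio bounds; they agree to first order as \<open>u\<close>
  grows.\<close>

lemma std_normal_two_sided_tail:
  assumes u: "0 < u"
  defines "q \<equiv> 1 - measure std_normal_distribution {-u..u}"
  shows "q \<le> 2 * std_normal_density u / u" and "2 * std_normal_density u / u \<le> (1 + 1 / u\<^sup>2) * q"
proof -
  let ?N = std_normal_distribution
  txt \<open>On \<open>{u..}\<close> the factor in this derivative lies between \<open>1\<close> and \<open>1 + 1 / u\<^sup>2\<close>, so
    integrating it brackets the tail.\<close>
  have deriv: "((\<lambda>x. - (std_normal_density x / x)) has_real_derivative std_normal_density x * (1 + 1 / x\<^sup>2)) (at x)"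
    if "0 < x" for x
  proof -
    have "((\<lambda>x. - (c * exp (- x\<^sup>2 / 2) / x)) has_real_derivative c * exp (- x\<^sup>2 / 2) * (1 + 1 / x\<^sup>2)) (at x)" for c
      using that by (auto intro!: derivative_eq_intros simp: field_simps power2_eq_square)
    then show ?thesis unfolding std_normal_density_def .
  qed
  have lim: "((\<lambda>x. - (std_normal_density x / x)) \<longlongrightarrow> 0) at_top"
    unfolding std_normal_density_def by real_asymp
  have I: "(\<integral>\<^sup>+x. ennreal (std_normal_density x * (1 + 1 / x\<^sup>2)) * indicator {u..} x \<partial>lborel) = std_normal_density u / u"
    using nn_integral_FTC_atLeast[where F = "\<lambda>x. - (std_normal_density x / x)" and a = u and T = 0
        and f = "\<lambda>x. std_normal_density x * (1 + 1 / x\<^sup>2)"] deriv lim u by simp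
  have em: "emeasure ?N A = (\<integral>\<^sup>+x. ennreal (std_normal_density x) * indicator A x \<partial>lborel)" if "A \<in> sets borel" for A
    using that by (subst emeasure_density) auto
  have sym: "emeasure ?N {..-u} = emeasure ?N {u..}"
  proof -
    have "emeasure ?N {..-u} = (\<integral>\<^sup>+x. ennreal (std_normal_density x) * indicator {..-u} x \<partial>lborel)"
      by (rule em) simp
    also have "\<dots> = (\<integral>\<^sup>+x. ennreal (std_normal_density (- x)) * indicator {..-u} (- x) \<partial>lborel)"
      by (subst nn_integral_real_affine[where c = "-1" and t = 0]) auto
    also have "\<dots> = (\<integral>\<^sup>+x. ennreal (std_normal_density x) * indicator {u..} x \<partial>lborel)"
      by (intro nn_integral_cong) (auto simp: std_normal_density_def indicator_def)
    also have "\<dots> = emeasure ?N {u..}" by (rule em[symmetric]) simp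
    finally show ?thesis .
  qed
  have null: "emeasure ?N {x} = 0" for x
    by (subst em) (auto intro!: nn_integral_null_set simp: nn_integral_indicator_singleton')
  have "q = measure ?N (space ?N - {-u..u})"
    unfolding q_def by (subst std_normal.prob_compl) auto
  \<comment> \<open>The complement consists of two open half-lines; closing them adds only the two
    null points -u and u.\<close>
  also have "space ?N - {-u..u} = ({..-u} \<union> {u..}) - {-u, u}"
    using u by auto
  also have "measure ?N \<dots> = measure ?N ({..-u} \<union> {u..})"
  proof (rule measure_Diff_null_set)
    have "{-u} \<union> {u} \<in> null_sets ?N"
      by (intro null_sets.Un) (simp_all add: null_sets_def null)
    then show "{-u, u} \<in> null_sets ?N" by (simp add: insert_commute)
  qed simp
  also have "\<dots> = measure ?N {..-u} + measure ?N {u..}"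
    using u by (intro std_normal.finite_measure_Union) auto
  also have "\<dots> = 2 * measure ?N {u..}"
    using sym by (simp add: measure_def)
  finally have q: "q = 2 * measure ?N {u..}" .
  have "emeasure ?N {u..} \<le> ennreal (std_normal_density u / u)"
    unfolding I[symmetric]
    by (subst em) (auto intro!: nn_integral_mono simp: indicator_def mult_left_le ennreal_leI algebra_simps)
  then show "q \<le> 2 * std_normal_density u / u"
    using u by (simp add: q std_normal.emeasure_eq_measure)
  have "ennreal (std_normal_density u / u) \<le> (\<integral>\<^sup>+x. ennreal (1 + 1 / u\<^sup>2) * (ennreal (std_normal_density x) * indicator {u..} x) \<partial>lborel)"
    unfolding I[symmetric]
  proof (intro nn_integral_mono)
    fix x
    show "ennreal (std_normal_density x * (1 + 1 / x\<^sup>2)) * indicator {u..} x \<le>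
      ennreal (1 + 1 / u\<^sup>2) * (ennreal (std_normal_density x) * indicator {u..} x)"
    proof (cases "u \<le> x")
      case True
      then have "1 / x\<^sup>2 \<le> 1 / u\<^sup>2" using u by (intro divide_left_mono power_mono mult_pos_pos) auto
      then have "std_normal_density x * (1 + 1 / x\<^sup>2) \<le> (1 + 1 / u\<^sup>2) * std_normal_density x"
        by (subst mult.commute) (intro mult_right_mono, auto)
      then have "ennreal (std_normal_density x * (1 + 1 / x\<^sup>2)) \<le> ennreal (1 + 1 / u\<^sup>2) * ennreal (std_normal_density x)"
        by (subst ennreal_mult'[symmetric], simp) (rule ennreal_leI)
      then show ?thesis using True by simp
    qed simp
  qed
  also have "\<dots> = ennreal (1 + 1 / u\<^sup>2) * emeasure ?N {u..}"
    by (subst nn_integral_cmult) (auto simp: em)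
  also have "\<dots> = ennreal ((1 + 1 / u\<^sup>2) * measure ?N {u..})"
    unfolding std_normal.emeasure_eq_measure by (rule ennreal_mult'[symmetric]) simp
  finally have "std_normal_density u / u \<le> (1 + 1 / u\<^sup>2) * measure ?N {u..}"
    by (rule ennreal_le_iff[THEN iffD1, rotated]) simp
  then show "2 * std_normal_density u / u \<le> (1 + 1 / u\<^sup>2) * q"
    by (simp add: q)
qed

text \<open>Convergence of \<open>k * q\<close> with growing \<open>k\<close> forces
  \<open>q\<close> to 0. Then ln(1 - q) lies between -q - 2 q^2 and -q, and the discrepancy k q^2 =
  (k q) q vanishes.\<close>

lemma tendsto_one_minus_power:
  fixes q N :: "nat \<Rightarrow> real" and k :: "nat \<Rightarrow> nat"
  assumes q: "\<And>n. 0 \<le> q n" and k: "filterlim k at_top sequentially"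
    and lim: "(\<lambda>n. real (k n) * q n) \<longlonglongrightarrow> c"
  shows "(\<lambda>n. (1 - q n) ^ k n) \<longlonglongrightarrow> exp (- c)"
proof -
  have kr: "filterlim (\<lambda>n. real (k n)) at_top sequentially"
    by (rule filterlim_compose[OF filterlim_real_sequentially k])
  have "(\<lambda>n. real (k n) * q n / real (k n)) \<longlonglongrightarrow> 0"
    by (rule real_tendsto_divide_at_top[OF lim kr])
  moreover have kpos: "\<forall>\<^sub>F n in sequentially. 0 < k n"
    using k unfolding filterlim_at_top by (auto elim: allE[of _ 1] simp: Suc_le_eq)
  moreover have "\<forall>\<^sub>F n in sequentially. real (k n) * q n / real (k n) = q n"
    using kpos by eventually_elim simp
  ultimately have q0: "q \<longlonglongrightarrow> 0"
    using tendsto_cong by fastforce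
  have small: "\<forall>\<^sub>F n in sequentially. q n < 1 / 2"
    by (rule order_tendstoD(2)[OF q0]) simp
  have "(\<lambda>n. real (k n) * ln (1 - q n)) \<longlonglongrightarrow> - c"
  proof (rule tendsto_sandwich)
    show "\<forall>\<^sub>F n in sequentially. - (real (k n) * q n) - 2 * (real (k n) * q n) * q n \<le> real (k n) * ln (1 - q n)"
      using small
    proof eventually_elim
      case (elim n)
      have "- q n - 2 * (q n)\<^sup>2 \<le> ln (1 - q n)"
        using q[of n] elim by (intro ln_one_minus_pos_lower_bound) auto
      then have "real (k n) * (- q n - 2 * (q n)\<^sup>2) \<le> real (k n) * ln (1 - q n)"
        by (rule mult_left_mono) simp
      then show ?case by (simp add: algebra_simps power2_eq_square)
    qed
    show "\<forall>\<^sub>F n in sequentially. real (k n) * ln (1 - q n) \<le> - (real (k n) * q n)"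
      using small
    proof eventually_elim
      case (elim n)
      have "ln (1 - q n) \<le> - q n"
        using q[of n] elim by (intro ln_one_minus_pos_upper_bound) auto
      then have "real (k n) * ln (1 - q n) \<le> real (k n) * (- q n)"
        by (rule mult_left_mono) simp
      then show ?case by simp
    qed
    show "(\<lambda>n. - (real (k n) * q n)) \<longlonglongrightarrow> - c" by (intro tendsto_intros lim)
    have "(\<lambda>n. - (real (k n) * q n) - 2 * (real (k n) * q n) * q n) \<longlonglongrightarrow> - c - 2 * c * 0"
      by (intro tendsto_intros lim q0)
    then show "(\<lambda>n. - (real (k n) * q n) - 2 * (real (k n) * q n) * q n) \<longlonglongrightarrow> - c" by simp
  qed
  then have "(\<lambda>n. exp (real (k n) * ln (1 - q n))) \<longlonglongrightarrow> exp (- c)"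
    by (rule tendsto_exp)
  moreover have "\<forall>\<^sub>F n in sequentially. exp (real (k n) * ln (1 - q n)) = (1 - q n) ^ k n"
    using small by eventually_elim (simp add: exp_of_nat_mult)
  ultimately show ?thesis by (simp add: tendsto_cong)
qed

text \<open>This is the Gumbel limit for independent coordinates: the expected number of exceedances
  of the threshold tends to exp(-z).\<close>

lemma std_normal_gumbel_limit:
  fixes N :: "nat \<Rightarrow> nat"
  assumes N: "filterlim N at_top sequentially"
  shows "(\<lambda>n. measure std_normal_distribution {- (a_chi (N n) * z + b_chi (N n))..a_chi (N n) * z + b_chi (N n)} ^ N n)
     \<longlonglongrightarrow> exp (- exp (- z))"
proof -
  define U where "U x = 1 / sqrt (2 * ln x) * z + (sqrt (2 * ln x) - (ln (ln x) + ln pi) / (2 * sqrt (2 * ln x)))" for x :: real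
  have Nr: "filterlim (\<lambda>n. real (N n)) at_top sequentially"
    by (rule filterlim_compose[OF filterlim_real_sequentially N])
  define u where "u n = U (real (N n))" for n
  define q where "q n = 1 - measure std_normal_distribution {- u n..u n}" for n
  define t where "t n = real (N n) * (2 * std_normal_density (u n) / u n)" for n
  have u: "filterlim u at_top sequentially"
    unfolding u_def U_def by (rule filterlim_compose[OF gumbel_threshold_asymptotics(1) Nr])
  have t: "t \<longlonglongrightarrow> exp (- z)"
    unfolding t_def u_def U_def by (rule filterlim_compose[OF gumbel_threshold_asymptotics(3) Nr])
  have upos: "\<forall>\<^sub>F n in sequentially. 0 < u n"
    using u by (simp add: filterlim_at_top_dense)
  have "(\<lambda>n. real (N n) * q n) \<longlonglongrightarrow> exp (- z)"
  proof (rule tendsto_sandwich)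
    show "\<forall>\<^sub>F n in sequentially. real (N n) * q n \<le> t n"
      using upos
    proof eventually_elim
      case (elim n)
      show ?case
        unfolding t_def q_def by (rule mult_left_mono[OF std_normal_two_sided_tail(1)[OF elim]]) simp
    qed
    show "\<forall>\<^sub>F n in sequentially. t n / (1 + 1 / (u n)\<^sup>2) \<le> real (N n) * q n"
      using upos
    proof eventually_elim
      case (elim n)
      have "t n \<le> real (N n) * ((1 + 1 / (u n)\<^sup>2) * q n)"
        unfolding t_def q_def by (rule mult_left_mono[OF std_normal_two_sided_tail(2)[OF elim]]) simp
      moreover have "0 < 1 + 1 / (u n)\<^sup>2" by (simp add: add_pos_nonneg)
      ultimately show ?case by (simp only: pos_divide_le_eq mult_ac)
    qed
    have "(\<lambda>n. 1 / (u n)\<^sup>2) \<longlonglongrightarrow> 0"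
      by (rule real_tendsto_divide_at_top[OF tendsto_const filterlim_pow_at_top[OF _ u]]) simp
    then have "(\<lambda>n. t n / (1 + 1 / (u n)\<^sup>2)) \<longlonglongrightarrow> exp (- z) / (1 + 0)"
      by (intro tendsto_divide t tendsto_add tendsto_const) simp_all
    then show "(\<lambda>n. t n / (1 + 1 / (u n)\<^sup>2)) \<longlonglongrightarrow> exp (- z)" by simp
  qed (rule t)
  then have "(\<lambda>n. (1 - q n) ^ N n) \<longlonglongrightarrow> exp (- exp (- z))"
    by (intro tendsto_one_minus_power N) (simp_all add: q_def)
  then show ?thesis
    unfolding q_def u_def U_def a_chi_def b_chi_def by simp
qed

text \<open>A single estimate of exp(-u^2) by \<open>C\<close> times ln N / N^2 is raised to the
  power \<open>1 / (1 + \<rho>)\<close>. As this power is at most 1 and \<open>C\<close> at least 1,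
  the same constant serves for every \<open>\<rho>\<close>.\<close>

lemma eventually_exp_threshold_le_powr:
  fixes N :: "nat \<Rightarrow> nat"
  assumes N: "filterlim N at_top sequentially"
  obtains C where "0 < C" "\<forall>\<^sub>F n in sequentially. \<forall>\<rho>\<ge>0.
    exp (- (a_chi (N n) * z + b_chi (N n))\<^sup>2 / (1 + \<rho>)) \<le> C * (ln (real (N n)) / (real (N n))\<^sup>2) powr (1 / (1 + \<rho>))"
proof -
  define U where "U x = 1 / sqrt (2 * ln x) * z + (sqrt (2 * ln x) - (ln (ln x) + ln pi) / (2 * sqrt (2 * ln x)))" for x :: real
  have Nr: "filterlim (\<lambda>n. real (N n)) at_top sequentially"
    by (rule filterlim_compose[OF filterlim_real_sequentially N])
  \<comment> \<open>The limit \<open>pi * exp (- 2 * z)\<close> plus 1 is strictly above the limit,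
    so eventually a bound, and also at least 1.\<close>
  define C where "C = 1 + pi * exp (- 2 * z)"
  have C: "1 \<le> C" by (simp add: C_def)
  have "\<forall>\<^sub>F x in at_top. exp (- (U x)\<^sup>2) * x\<^sup>2 / ln x < C"
    using gumbel_threshold_asymptotics(2)[of z, folded U_def]
    by (rule order_tendstoD(2)) (simp add: C_def)
  moreover have "\<forall>\<^sub>F x::real in at_top. 1 < x" by (rule eventually_gt_at_top)
  ultimately have "\<forall>\<^sub>F x in at_top. \<forall>\<rho>\<ge>0. exp (- (U x)\<^sup>2 / (1 + \<rho>)) \<le> C * (ln x / x\<^sup>2) powr (1 / (1 + \<rho>))"
  proof eventually_elim
    case (elim x)
    show ?case
    proof (intro allI impI)
      fix \<rho> :: real assume \<rho>: "0 \<le> \<rho>"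
      have "exp (- (U x)\<^sup>2) \<le> C * (ln x / x\<^sup>2)"
        using elim by (simp add: field_simps)
      then have "exp (- (U x)\<^sup>2) powr (1 / (1 + \<rho>)) \<le> (C * (ln x / x\<^sup>2)) powr (1 / (1 + \<rho>))"
        using \<rho> by (intro powr_mono2) auto
      also have "\<dots> = C powr (1 / (1 + \<rho>)) * (ln x / x\<^sup>2) powr (1 / (1 + \<rho>))"
        by (rule powr_mult)
      also have "\<dots> \<le> C powr 1 * (ln x / x\<^sup>2) powr (1 / (1 + \<rho>))"
        using C \<rho> by (intro mult_right_mono powr_mono) auto
      finally show "exp (- (U x)\<^sup>2 / (1 + \<rho>)) \<le> C * (ln x / x\<^sup>2) powr (1 / (1 + \<rho>))"
        using C by (simp add: powr_def)
    qed
  qed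
  then have "\<forall>\<^sub>F n in sequentially. \<forall>\<rho>\<ge>0. exp (- (U (real (N n)))\<^sup>2 / (1 + \<rho>))
      \<le> C * (ln (real (N n)) / (real (N n))\<^sup>2) powr (1 / (1 + \<rho>))"
    using Nr unfolding filterlim_iff by blast
  then show ?thesis
    using C by (intro that[of C]) (simp_all add: U_def a_chi_def b_chi_def)
qed

theorem theoremA8:
  fixes \<Omega> :: "nat \<Rightarrow> 'i set"
    and M :: "nat \<Rightarrow> 'a measure"
    and \<xi> :: "nat \<Rightarrow> 'i \<Rightarrow> 'a \<Rightarrow> real"
    and \<kappa> :: "nat \<Rightarrow> 'i \<Rightarrow> 'i \<Rightarrow> real"
  assumes "\<And>n. finite (\<Omega> n)"
    and "incseq (\<lambda>n. card (\<Omega> n))"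
    and "filterlim (\<lambda>n. card (\<Omega> n)) at_top sequentially"
    and "\<And>n. prob_space (M n)"
    and "\<And>n. standardized_normal_vector (M n) (\<Omega> n) (\<xi> n)"
    and "\<And>n. has_covariance_matrix (M n) (\<Omega> n) (\<xi> n) (\<kappa> n)"
    and "(\<lambda>n. \<Sum>(\<omega>, \<omega>') \<in> {(\<omega>, \<omega>'). \<omega> \<in> \<Omega> n \<and> \<omega>' \<in> \<Omega> n \<and> \<omega> \<noteq> \<omega>'}.
            \<bar>\<kappa> n \<omega> \<omega>'\<bar> *
            (ln (real (card (\<Omega> n))) / (real (card (\<Omega> n)))\<^sup>2) powr (1 / (1 + \<bar>\<kappa> n \<omega> \<omega>'\<bar>)))
          \<longlonglongrightarrow> 0"
  shows "gumbel_type M (\<lambda>n x. max_norm (\<Omega> n) (\<lambda>\<omega>. \<xi> n \<omega> x))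
           (\<lambda>n. a_chi (card (\<Omega> n))) (\<lambda>n. b_chi (card (\<Omega> n)))"
  unfolding gumbel_type_def
proof
  fix z :: real
  define u where "u n = a_chi (card (\<Omega> n)) * z + b_chi (card (\<Omega> n))" for n
  define S where "S n = (\<Sum>i\<in>\<Omega> n. \<Sum>j\<in>\<Omega> n - {i}. \<bar>\<kappa> n i j\<bar> *
      (ln (real (card (\<Omega> n))) / (real (card (\<Omega> n)))\<^sup>2) powr (1 / (1 + \<bar>\<kappa> n i j\<bar>)))" for n
  \<comment> \<open>The sum over off-diagonal pairs becomes the iterated sum that occurs in the
    comparison inequality.\<close>
  have "{(\<omega>, \<omega>'). \<omega> \<in> \<Omega> n \<and> \<omega>' \<in> \<Omega> n \<and> \<omega> \<noteq> \<omega>'} = Sigma (\<Omega> n) (\<lambda>i. \<Omega> n - {i})" for n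
    by auto
  then have S: "S \<longlonglongrightarrow> 0"
    using assms(7) assms(1) by (simp add: S_def[abs_def] sum.Sigma)
  note G = prob_space.standardized_normal_vector_gaussian_family[OF assms(4,1,5,6)]
  have u: "filterlim u at_top sequentially"
    unfolding u_def a_chi_def b_chi_def
    by (rule filterlim_compose[OF gumbel_threshold_asymptotics(1) filterlim_compose[OF filterlim_real_sequentially assms(3)]])
  obtain C where C: "0 < C" "\<forall>\<^sub>F n in sequentially. \<forall>\<rho>\<ge>0. exp (- (u n)\<^sup>2 / (1 + \<rho>))
      \<le> C * (ln (real (card (\<Omega> n))) / (real (card (\<Omega> n)))\<^sup>2) powr (1 / (1 + \<rho>))"
    unfolding u_def by (rule eventually_exp_threshold_le_powr[OF assms(3)])
  define P where "P n = \<P>(x in M n. \<forall>i\<in>\<Omega> n. \<bar>\<xi> n i x\<bar> \<le> u n)" for n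
  define Q where "Q n = measure std_normal_distribution {- u n..u n} ^ card (\<Omega> n)" for n
  have "\<forall>\<^sub>F n in sequentially. 0 < u n" using u by (simp add: filterlim_at_top_dense)
  with C(2) have "\<forall>\<^sub>F n in sequentially. norm (P n - Q n) \<le> C / 2 * S n"
  proof eventually_elim
    case (elim n)
    have "\<bar>P n - Q n\<bar> \<le> (\<Sum>i\<in>\<Omega> n. \<Sum>j\<in>\<Omega> n - {i}. \<bar>\<kappa> n i j\<bar> * exp (- (u n)\<^sup>2 / (1 + \<bar>\<kappa> n i j\<bar>))) / 2"
      unfolding P_def Q_def by (rule gaussian_comparison_max[OF G(1) assms(1) G(2) G(4) G(3) elim(2)])
    also have "\<dots> \<le> (\<Sum>i\<in>\<Omega> n. \<Sum>j\<in>\<Omega> n - {i}. \<bar>\<kappa> n i j\<bar> *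
        (C * (ln (real (card (\<Omega> n))) / (real (card (\<Omega> n)))\<^sup>2) powr (1 / (1 + \<bar>\<kappa> n i j\<bar>)))) / 2"
      using elim(1) by (intro divide_right_mono sum_mono mult_left_mono) auto
    also have "\<dots> = C / 2 * S n"
      by (simp add: S_def sum_distrib_left sum_divide_distrib mult_ac)
    finally show ?case by simp
  qed
  then have "(\<lambda>n. P n - Q n) \<longlonglongrightarrow> 0"
    by (rule Lim_null_comparison) (use tendsto_mult_right_zero[OF S] in simp)
  moreover have "Q \<longlonglongrightarrow> exp (- exp (- z))"
    unfolding Q_def u_def by (rule std_normal_gumbel_limit[OF assms(3)])
  ultimately have "(\<lambda>n. P n - Q n + Q n) \<longlonglongrightarrow> 0 + exp (- exp (- z))"
    by (rule tendsto_add)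
  \<comment> \<open>The maximum is a meaningful value only for a nonempty index set, which is
    guaranteed from some n on.\<close>
  moreover have "\<forall>\<^sub>F n in sequentially. 1 \<le> card (\<Omega> n)"
    using assms(3) unfolding filterlim_at_top by blast
  then have "\<forall>\<^sub>F n in sequentially. P n - Q n + Q n =
      \<P>(x in M n. max_norm (\<Omega> n) (\<lambda>\<omega>. \<xi> n \<omega> x) \<le> a_chi (card (\<Omega> n)) * z + b_chi (card (\<Omega> n)))"
  proof eventually_elim
    case (elim n)
    then have "\<Omega> n \<noteq> {}" by auto
    then show ?case
      using assms(1) by (simp add: P_def max_norm_def u_def)
  qed
  ultimately show "(\<lambda>n. \<P>(x in M n. max_norm (\<Omega> n) (\<lambda>\<omega>. \<xi> n \<omega> x) \<le> a_chi (card (\<Omega> n)) * z + b_chi (card (\<Omega> n))))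
      \<longlonglongrightarrow> exp (- exp (- z))"
    by (simp add: tendsto_cong)
qed

end
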